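(* Let $r,n_1,\ldots,n_r,M,N$ be positive integers and $n=n_1+\cdots+n_r$. Let $\mathcal{H}$ be a real Hilbert space and let $\{X_g:g\in\mathcal{H}\}$ be a family of $M\times N$ random matrices such that the $ij$th entry of $X_g$ is $\frac1{\sqrt N}f^{(g)}_{ij}$, where $\{f^{(g)}_{ij}\}$ is a centred (jointly) Gaussian family with $f^{(g)}_{ij}$ and $f^{(h)}_{i'j'}$ independent for $(i,j)\neq(i',j')$ and $\mathbb{E}(f^{(g)}_{ij}f^{(h)}_{ij})=\langle g,h\rangle$. Let $D_1,\ldots,D_{2n}$ be arbitrary constant matrices, with $D_m$ of size $M\times M$ for $m$ odd and $N\times N$ for $m$ even, and let $g_1,\ldots,g_{2n}\in\mathcal{H}$. With $Y_1,\ldots,Y_r$, the permutations $\gamma_+,\gamma_-,\hat\pi$ and the notation $\gamma_-^{-1}\hat\pi\gamma_+/2$ and $\mathrm{Tr}_\sigma$ as defined in the context, $$\mathbb{E}(Y_1\cdots Y_r)=N^{-n-r}\sum_{\pi\in\mathcal{P}_2(2n)}\ \prod_{\{k,l\}\in\pi}\langle g_k,g_l\rangle\ \mathrm{Tr}_{\gamma_-^{-1}\hat\pi\gamma_+/2}(D_1,\ldots,D_{2n}).$$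
   Context: Notation: $[m]=\{1,\ldots,m\}$ and $[\pm m]=\{1,\ldots,m\}\cup\{-1,\ldots,-m\}$. $\mathrm{Tr}$ is the usual trace and $\mathrm{tr}:=\frac1N\mathrm{Tr}$ (always normalised by $N$). Matrices have real entries. Put $s_0=0$ and $s_k=n_1+\cdots+n_k$. For $1\le k\le r$, $$Y_k:=\mathrm{tr}\left(X_{g_{2s_{k-1}+1}}^TD_{2s_{k-1}+1}X_{g_{2s_{k-1}+2}}D_{2s_{k-1}+2}\cdots X_{g_{2s_k-1}}^TD_{2s_k-1}X_{g_{2s_k}}D_{2s_k}\right).$$ $\mathcal{P}_2(2n)$ is the set of pairings of $[2n]$, i.e. partitions of $[2n]$ into blocks of exactly two elements. A pairing $\pi$ is identified with the permutation of $[2n]$ that swaps the two elements of each block; it is viewed as a permutation of $[\pm 2n]$ by letting it fix every negative integer. Permutations of $[\pm2n]$ (composed right to left): $\delta(k)=-k$; $\delta'(k)=-k$ if $|k|$ is odd and $\delta'(k)=k$ if $|k|$ is even (the odd positions are those where the random matrix appears transposed); $\hat\pi:=\delta'\pi\delta\pi\delta'$; $\gamma_+$ is the permutation whose cycles on $[2n]$ are $(2s_{k-1}+1,2s_{k-1}+2,\ldots,2s_k)$ for $1\le k\le r$ and which fixes every negative integer; $\gamma_-$ is the permutation whose cycles on the negative integers are $(-(2s_{k-1}+1),-(2s_{k-1}+2),\ldots,-2s_k)$ for $1\le k\le r$ and which fixes every positive integer. The cycles of $\gamma_-^{-1}\hat\pi\gamma_+$ come in pairs of distinct cycles $(k_1,\ldots,k_m)$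 and $(-k_m,\ldots,-k_1)$. A cycle is called particular if its element of lowest absolute value is positive. $\gamma_-^{-1}\hat\pi\gamma_+/2$ denotes the permutation consisting of the particular cycles of $\gamma_-^{-1}\hat\pi\gamma_+$ (including fixed points), acting on the set of integers appearing in these cycles. For a permutation $\sigma$ of a subset of $[\pm m]$ and matrices $A_1,\ldots,A_m$, write $A_k^{(1)}=A_k$ and $A_k^{(-1)}=A_k^T$, and define $$\mathrm{Tr}_\sigma(A_1,\ldots,A_m):=\prod_{(c_1,\ldots,c_l)}\mathrm{Tr}\left(A_{|c_1|}^{(\mathrm{sgn}(c_1))}\cdots A_{|c_l|}^{(\mathrm{sgn}(c_l))}\right),$$ the product being over all cycles $(c_1,\ldots,c_l)$ of $\sigma$, including fixed points. *)

theory Defs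
  imports
    "HOL-Probability.Probability"
    "HOL-Combinatorics.Combinatorics"
    "Jordan_Normal_Form.Matrix"
begin

subsection \<open>Gaussian families\<close>

text \<open>Point masses count as Gaussian (variance 0), as is needed for linear combinations.\<close>

definition gaussian_rv :: "'w measure \<Rightarrow> ('w \<Rightarrow> real) \<Rightarrow> bool" where
  "gaussian_rv P Z \<longleftrightarrow> Z \<in> borel_measurable P \<and>
     ((\<exists>\<mu> \<sigma>. \<sigma> > 0 \<and> distributed P lborel Z (normal_density \<mu> \<sigma>)) \<or>
      (\<exists>\<mu>. AE \<omega> in P. Z \<omega> = \<mu>))"

definition jointly_gaussian :: "'w measure \<Rightarrow> 'i set \<Rightarrow> ('i \<Rightarrow> 'w \<Rightarrow> real) \<Rightarrow> bool" where
  "jointly_gaussian P I Z \<longleftrightarrow>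
     (\<forall>J c. finite J \<and> J \<subseteq> I \<longrightarrow> gaussian_rv P (\<lambda>\<omega>. \<Sum>i\<in>J. c i * Z i \<omega>))"

subsection \<open>Matrices\<close>

definition mat_trace :: "real mat \<Rightarrow> real" where
  "mat_trace A = (\<Sum>i<dim_row A. A $$ (i, i))"

text \<open>The factors may be rectangular. The value at the empty list is a dummy.\<close>

fun mat_list_prod :: "real mat list \<Rightarrow> real mat" where
  "mat_list_prod [] = 1\<^sub>m 0"
| "mat_list_prod [A] = A"
| "mat_list_prod (A # B # As) = A * mat_list_prod (B # As)"

definition signed_mat :: "(nat \<Rightarrow> real mat) \<Rightarrow> int \<Rightarrow> real mat" where
  "signed_mat A c = (if c > 0 then A (nat c) else transpose_mat (A (nat (- c))))"

subsection \<open>The random variables \<open>Y\<^sub>k\<close>\<close>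

definition partial_sum :: "(nat \<Rightarrow> nat) \<Rightarrow> nat \<Rightarrow> nat" where
  "partial_sum ns k = (\<Sum>i = 1..k. ns i)"

definition Y :: "nat \<Rightarrow> (nat \<Rightarrow> nat) \<Rightarrow> ('h \<Rightarrow> 'w \<Rightarrow> real mat) \<Rightarrow> (nat \<Rightarrow> 'h) \<Rightarrow>
    (nat \<Rightarrow> real mat) \<Rightarrow> nat \<Rightarrow> 'w \<Rightarrow> real" where
  "Y N ns X g D k \<omega> =
     1 / real N * mat_trace (mat_list_prod (concat (map
       (\<lambda>j. [if odd j then transpose_mat (X (g j) \<omega>) else X (g j) \<omega>, D j])
       [2 * partial_sum ns (k - 1) + 1 ..< 2 * partial_sum ns k + 1])))"

subsection \<open>Pairings and permutations of \<open>[\<plusminus>m]\<close>\<close>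

definition pm_set :: "nat \<Rightarrow> int set" where
  "pm_set m = {k. k \<noteq> 0 \<and> \<bar>k\<bar> \<le> int m}"

definition pairings :: "nat \<Rightarrow> nat set set set" where
  "pairings m = {\<pi>. partition_on {1..m} \<pi> \<and> (\<forall>B\<in>\<pi>. card B = 2)}"

definition pairing_perm :: "nat set set \<Rightarrow> int \<Rightarrow> int" where
  "pairing_perm \<pi> k =
     (if k > 0 \<and> nat k \<in> \<Union>\<pi> then int (THE l. {nat k, l} \<in> \<pi>) else k)"

text \<open>
  Permutations of \<open>[\<plusminus>m]\<close> are represented as functions on all integers that are the
  identity outside of \<open>[\<plusminus>m]\<close>.
\<close>

definition delta :: "nat \<Rightarrow> int \<Rightarrow> int" where
  "delta m k = (if \<bar>k\<bar> \<le> int m then - k else k)"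

definition delta' :: "nat \<Rightarrow> int \<Rightarrow> int" where
  "delta' m k = (if \<bar>k\<bar> \<le> int m \<and> odd \<bar>k\<bar> then - k else k)"

definition pi_hat :: "nat \<Rightarrow> nat set set \<Rightarrow> int \<Rightarrow> int" where
  "pi_hat m \<pi> = delta' m \<circ> pairing_perm \<pi> \<circ> delta m \<circ> pairing_perm \<pi> \<circ> delta' m"

definition block_list :: "(nat \<Rightarrow> nat) \<Rightarrow> nat \<Rightarrow> int list" where
  "block_list ns k = [2 * int (partial_sum ns (k - 1)) + 1 .. 2 * int (partial_sum ns k)]"

primrec gamma_plus :: "(nat \<Rightarrow> nat) \<Rightarrow> nat \<Rightarrow> int \<Rightarrow> int" where
  "gamma_plus ns 0 = id"
| "gamma_plus ns (Suc r) = gamma_plus ns r \<circ> cycle_of_list (block_list ns (Suc r))"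

primrec gamma_minus :: "(nat \<Rightarrow> nat) \<Rightarrow> nat \<Rightarrow> int \<Rightarrow> int" where
  "gamma_minus ns 0 = id"
| "gamma_minus ns (Suc r) =
     gamma_minus ns r \<circ> cycle_of_list (map uminus (block_list ns (Suc r)))"

subsection \<open>Particular cycles and traces along permutations\<close>

definition particular :: "int set \<Rightarrow> bool" where
  "particular C \<longleftrightarrow> (\<exists>k\<in>C. k > 0 \<and> (\<forall>c\<in>C. \<bar>k\<bar> \<le> \<bar>c\<bar>))"

text \<open>
  The permutation \<open>\<sigma>/2\<close> is given by its domain \<open>half_dom m \<sigma>\<close> and the map \<open>half_perm m \<sigma>\<close>.
\<close>

definition half_dom :: "nat \<Rightarrow> (int \<Rightarrow> int) \<Rightarrow> int set" where
  "half_dom m \<sigma> = {k \<in> pm_set m. particular (orbit \<sigma> k)}"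

definition half_perm :: "nat \<Rightarrow> (int \<Rightarrow> int) \<Rightarrow> int \<Rightarrow> int" where
  "half_perm m \<sigma> = perm_restrict \<sigma> (half_dom m \<sigma>)"

text \<open>
  For a permutation \<open>\<sigma>\<close> of \<open>S\<close> the cycles are the orbits of the elements of \<open>S\<close>;
  \<open>support \<sigma> c\<close> is the list \<open>[c, \<sigma> c, \<sigma> (\<sigma> c), \<dots>]\<close> running once through the cycle of \<open>c\<close>.
  Each cycle is written starting from its least element; by cyclicity of the trace
  the starting point does not matter.
\<close>

definition Tr_perm :: "int set \<Rightarrow> (int \<Rightarrow> int) \<Rightarrow> (nat \<Rightarrow> real mat) \<Rightarrow> real" where
  "Tr_perm S \<sigma> A =
     (\<Prod>C \<in> orbit \<sigma> ` S. mat_trace (mat_list_prod (map (signed_mat A) (support \<sigma> (Min C)))))"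

end

theory Submission
  imports Defs
begin

text \<open>
  The proof writes both sides as sums over index functions
  \<open>\<eta> : [\<plusminus>2n] \<rightarrow> \<nat>\<close> and compares the summands. The value \<open>\<eta> j\<close> is the row index of
  \<open>D\<^sub>j\<close> and \<open>\<eta> (-j)\<close> its column index; in the product \<open>\<cdots> D\<^sub>j X \<cdots>\<close> the latter is also the first
  index of the random factor at position \<open>\<gamma>\<^sub>+ j\<close>. Hence the random factor at position \<open>j\<close>, transposed
  or not, has the first index \<open>\<eta> (- \<gamma>\<^sub>+\<^sup>-\<^sup>1 j)\<close> and the second index \<open>\<eta> j\<close>, and
  \<open>Y\<^sub>1 \<cdots> Y\<^sub>r\<close> is a sum over \<open>\<eta>\<close> of a product of entries of the \<open>D\<^sub>j\<close> times a product of \<open>2n\<close> Gaussian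
  variables (lemma \<open>prod_Y_expansion\<close>).

  By Wick's formula (\<open>wick_formula\<close>) the expectation of the Gaussian product is a sum over the
  pairings \<open>\<pi>\<close>. The term of \<open>\<pi>\<close> is the product of the \<open>\<langle>g\<^sub>k, g\<^sub>l\<rangle>\<close> if the matrix positions
  that belong to paired variables coincide, and vanishes otherwise. Two paired factors
  of the same kind identify first index with first index; a transposed and an untransposed factor
  identify first index with second index. Reading this off for every \<open>c\<close> in \<open>[\<plusminus>2n]\<close> gives the
  equations \<open>\<eta> (-c) = \<eta> (\<sigma> c)\<close>, where \<open>\<sigma>\<close> is the permutation made from \<open>\<gamma>\<^sub>-\<close>, \<open>\<pi>\<close> and \<open>\<gamma>\<^sub>+\<close>
  (\<open>compatible_iff\<close>).

  These equations say that the column index of the matrix with signed label \<open>c\<close> is the row index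
  of the matrix with label \<open>\<sigma> c\<close>, where a negative label stands for a transpose. So the
  remaining sum over \<open>\<eta>\<close> is a product of traces along cycles of \<open>\<sigma>\<close>. Since \<open>\<sigma> (- \<sigma> c) = - c\<close> and no cycle
  contains both \<open>c\<close> and \<open>-c\<close>, the particular cycles contain exactly one of \<open>c\<close> and \<open>-c\<close>, and each
  \<open>D\<^sub>j\<close> is used exactly once (\<open>Tr_perm_half\<close>).
\<close>

section \<open>Wick's formula\<close>

lemma sum_lists_length_Suc:
  fixes F :: "'a list \<Rightarrow> 'b::comm_monoid_add"
  shows "(\<Sum>xs | set xs \<subseteq> T \<and> length xs = Suc m. F xs) =
         (\<Sum>x\<in>T. \<Sum>xs | set xs \<subseteq> T \<and> length xs = m. F (x # xs))"
proof -
  have "(\<Sum>x\<in>T. \<Sum>xs | set xs \<subseteq> T \<and> length xs = m. F (x # xs)) =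
        (\<Sum>(x, xs) \<in> T \<times> {xs. set xs \<subseteq> T \<and> length xs = m}. F (x # xs))"
    by (rule sum.cartesian_product)
  also have "\<dots> = (\<Sum>xs | set xs \<subseteq> T \<and> length xs = Suc m. F xs)"
    by (rule sum.reindex_bij_witness[where j = "\<lambda>(x, xs). x # xs" and i = "\<lambda>xs. (hd xs, tl xs)"])
       (auto simp: length_Suc_conv)
  finally show ?thesis ..
qed

lemma sum_permutations_of_set_Cons:
  fixes F :: "'a list \<Rightarrow> 'b::comm_monoid_add"
  assumes "finite A" "A \<noteq> {}"
  shows "(\<Sum>xs\<in>permutations_of_set A. F xs) =
         (\<Sum>x\<in>A. \<Sum>xs\<in>permutations_of_set (A - {x}). F (x # xs))"
proof -
  have "(\<Sum>x\<in>A. \<Sum>xs\<in>permutations_of_set (A - {x}). F (x # xs)) =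
        (\<Sum>(x, xs) \<in> (SIGMA x:A. permutations_of_set (A - {x})). F (x # xs))"
    using assms by (intro sum.Sigma) auto
  also have "\<dots> = (\<Sum>xs\<in>permutations_of_set A. F xs)"
    using assms
    by (intro sum.reindex_bij_witness[where j = "\<lambda>(x, xs). x # xs" and i = "\<lambda>xs. (hd xs, tl xs)"])
       (auto simp: permutations_of_set_nonempty)
  finally show ?thesis ..
qed

text \<open>
  Moebius inversion over the range of a list: a list of length \<open>card A\<close> whose range is all of \<open>A\<close>
  is an arrangement of \<open>A\<close>, and lists with range inside \<open>T\<close> are what powers of sums over \<open>T\<close>
  produce.
\<close>

lemma sum_permutations_of_set_polarization:
  fixes F :: "'a list \<Rightarrow> real"
  assumes "finite A"
  shows "(\<Sum>xs\<in>permutations_of_set A. F xs) =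
     (\<Sum>T\<in>Pow A. (-1) ^ (card A - card T) * (\<Sum>xs | set xs \<subseteq> T \<and> length xs = card A. F xs))"
proof -
  have "(\<Sum>xs | set xs \<subseteq> S \<and> length xs = card A. F xs) =
        (\<Sum>T\<in>Pow S. \<Sum>xs | set xs = T \<and> length xs = card A. F xs)" if "finite S" for S
  proof -
    have "(\<Sum>T\<in>Pow S. \<Sum>xs | xs \<in> {xs. set xs \<subseteq> S \<and> length xs = card A} \<and> set xs = T. F xs) =
          (\<Sum>xs | set xs \<subseteq> S \<and> length xs = card A. F xs)"
      using that by (intro sum.group) (auto simp: finite_lists_length_eq)
    moreover have "{xs. xs \<in> {xs. set xs \<subseteq> S \<and> length xs = card A} \<and> set xs = T} =
        {xs. set xs = T \<and> length xs = card A}" if "T \<in> Pow S" for T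
      using that by auto
    ultimately show ?thesis by simp
  qed
  from inclusion_exclusion_mobius[OF this assms]
  have "(\<Sum>xs | set xs = A \<and> length xs = card A. F xs) =
    (\<Sum>T\<in>Pow A. (-1) ^ (card A - card T) * (\<Sum>xs | set xs \<subseteq> T \<and> length xs = card A. F xs))" .
  moreover have "{xs. set xs = A \<and> length xs = card A} = permutations_of_set A"
    by (auto simp: permutations_of_set_def intro: card_distinct dest: distinct_card)
  ultimately show ?thesis by simp
qed

lemma power_sum_eq_sum_lists:
  fixes z :: "'a \<Rightarrow> real"
  assumes "finite T"
  shows "(\<Sum>i\<in>T. z i) ^ m = (\<Sum>xs | set xs \<subseteq> T \<and> length xs = m. prod_list (map z xs))"
proof (induction m)
  case 0
  have "{xs. set xs \<subseteq> T \<and> length xs = 0} = {[]}" by auto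
  then show ?case by simp
next
  case (Suc m)
  have "(\<Sum>i\<in>T. z i) ^ Suc m =
        (\<Sum>i\<in>T. z i * (\<Sum>xs | set xs \<subseteq> T \<and> length xs = m. prod_list (map z xs)))"
    by (simp add: Suc.IH sum_distrib_right)
  also have "\<dots> = (\<Sum>xs | set xs \<subseteq> T \<and> length xs = Suc m. prod_list (map z xs))"
    by (simp add: sum_lists_length_Suc sum_distrib_left)
  finally show ?case .
qed

text \<open>
  The value at lists of length less than 2 is the empty product. For a list of odd length the last
  element is ignored.
\<close>

fun pair_prod :: "('a \<Rightarrow> 'a \<Rightarrow> real) \<Rightarrow> 'a list \<Rightarrow> real" where
  "pair_prod C (x # y # xs) = C x y * pair_prod C xs"
| "pair_prod C _ = 1"

lemma power_double_sum_eq_sum_lists: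
  assumes "finite T"
  shows "(\<Sum>i\<in>T. \<Sum>j\<in>T. C i j) ^ n =
         (\<Sum>xs | set xs \<subseteq> T \<and> length xs = 2 * n. pair_prod C xs)"
proof (induction n)
  case 0
  have "{xs. set xs \<subseteq> T \<and> length xs = 0} = {[]}" by auto
  then show ?case by simp
next
  case (Suc n)
  have "(\<Sum>i\<in>T. \<Sum>j\<in>T. C i j) ^ Suc n = (\<Sum>i\<in>T. \<Sum>j\<in>T. C i j *
          (\<Sum>xs | set xs \<subseteq> T \<and> length xs = 2 * n. pair_prod C xs))"
    by (simp add: Suc.IH sum_distrib_right)
  also have "\<dots> = (\<Sum>xs | set xs \<subseteq> T \<and> length xs = Suc (Suc (2 * n)). pair_prod C xs)"
    using assms by (simp only: sum_lists_length_Suc sum_distrib_left pair_prod.simps)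
  finally show ?case by simp
qed

text \<open>
  Polarization. It reduces mixed moments to moments of sums, and a sum of jointly Gaussian variables
  is a single Gaussian variable.
\<close>

lemma prod_via_powers_of_sums:
  fixes z :: "'a \<Rightarrow> real"
  assumes "finite A"
  shows "(\<Prod>a\<in>A. z a) =
    (\<Sum>T\<in>Pow A. (-1) ^ (card A - card T) * (\<Sum>i\<in>T. z i) ^ card A) / fact (card A)"
proof -
  have "(\<Sum>T\<in>Pow A. (-1) ^ (card A - card T) * (\<Sum>i\<in>T. z i) ^ card A) =
        (\<Sum>xs\<in>permutations_of_set A. prod_list (map z xs))"
    unfolding sum_permutations_of_set_polarization[OF assms]
    using assms by (intro sum.cong refl) (auto simp: power_sum_eq_sum_lists finite_subset)
  also have "\<dots> = (\<Sum>xs\<in>permutations_of_set A. \<Prod>a\<in>A. z a)"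
    by (intro sum.cong refl)
       (metis permutations_of_setD prod.distinct_set_conv_list)
  also have "\<dots> = fact (card A) * (\<Prod>a\<in>A. z a)"
    using assms by simp
  finally show ?thesis by simp
qed

definition pair_partitions :: "'a set \<Rightarrow> 'a set set set" where
  "pair_partitions A = {\<pi>. partition_on A \<pi> \<and> (\<forall>B\<in>\<pi>. card B = 2)}"

lemma finite_pair_partitions: "finite A \<Longrightarrow> finite (pair_partitions A)"
  unfolding pair_partitions_def
  by (rule finite_subset[OF _ finitely_many_partition_on]) auto

lemma card_pair_partition:
  assumes "finite A" "\<pi> \<in> pair_partitions A"
  shows "card A = 2 * card \<pi>"
proof -
  have "partition_on A \<pi>" and two: "\<And>B. B \<in> \<pi> \<Longrightarrow> card B = 2"
    using assms by (auto simp: pair_partitions_def)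
  then have "card A = (\<Sum>B\<in>\<pi>. card B)"
    using assms by (intro product_partition) (auto intro: card_ge_0_finite)
  then show ?thesis using two by simp
qed

lemma pair_partitions_empty: "pair_partitions {} = {{}}"
  by (auto simp: pair_partitions_def partition_on_empty)

lemma card_2_Min_Max:
  fixes B :: "'a::linorder set"
  assumes "card B = 2"
  shows "B = {Min B, Max B} \<and> Min B < Max B"
proof -
  obtain x y where "B = {x, y}" "x \<noteq> y" using assms by (auto simp: card_2_iff)
  then show ?thesis by (auto simp: min_def max_def)
qed

lemma sum_ordered_pairs:
  fixes A :: "'a::linorder set" and G :: "'a \<Rightarrow> 'a \<Rightarrow> real"
  assumes "finite A" and sym: "\<And>x y. x \<in> A \<Longrightarrow> y \<in> A \<Longrightarrow> G x y = G y x"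
  shows "(\<Sum>x\<in>A. \<Sum>y\<in>A - {x}. G x y) = 2 * (\<Sum>B | B \<subseteq> A \<and> card B = 2. G (Min B) (Max B))"
proof -
  let ?L = "{(x, y). x \<in> A \<and> y \<in> A \<and> x < y}" and ?R = "{(x, y). x \<in> A \<and> y \<in> A \<and> y < x}"
  have fin: "finite ?L" "finite ?R"
    by (rule finite_subset[of _ "A \<times> A"]; use assms in auto)+
  have "(\<Sum>x\<in>A. \<Sum>y\<in>A - {x}. G x y) = (\<Sum>(x, y) \<in> (SIGMA x:A. A - {x}). G x y)"
    using assms by (intro sum.Sigma) auto
  also have "(SIGMA x:A. A - {x}) = ?L \<union> ?R" by auto
  also have "(\<Sum>(x, y) \<in> ?L \<union> ?R. G x y) = (\<Sum>(x, y) \<in> ?L. G x y) + (\<Sum>(x, y) \<in> ?R. G x y)"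
    using fin by (intro sum.union_disjoint) auto
  also have "(\<Sum>(x, y) \<in> ?R. G x y) = (\<Sum>(x, y) \<in> ?L. G x y)"
    by (rule sum.reindex_bij_witness[where i = prod.swap and j = prod.swap]) (auto simp: sym)
  also have "(\<Sum>(x, y) \<in> ?L. G x y) = (\<Sum>B | B \<subseteq> A \<and> card B = 2. G (Min B) (Max B))"
    by (rule sum.reindex_bij_witness[where j = "\<lambda>(x, y). {x, y}" and i = "\<lambda>B. (Min B, Max B)"])
       (use card_2_Min_Max in \<open>auto simp: min_def max_def card_2_iff\<close>)
  finally show ?thesis by simp
qed

text \<open>
  Both sides count the pairs of a pairing and one of its blocks: the left side chooses the block
  first.
\<close>

lemma sum_pair_partitions_remove:
  fixes W :: "'a set \<Rightarrow> real"
  assumes "finite A"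
  shows "(\<Sum>B | B \<subseteq> A \<and> card B = 2. W B * (\<Sum>\<pi>\<in>pair_partitions (A - B). \<Prod>B\<in>\<pi>. W B)) =
         (\<Sum>\<pi>\<in>pair_partitions A. real (card \<pi>) * (\<Prod>B\<in>\<pi>. W B))"
proof -
  have fin: "finite \<pi>" if "\<pi> \<in> pair_partitions A" for \<pi>
    using that assms finite_elements by (auto simp: pair_partitions_def)
  have finB: "finite {B. B \<subseteq> A \<and> card B = 2}"
    using assms by simp
  have "(\<Sum>B | B \<subseteq> A \<and> card B = 2. W B * (\<Sum>\<pi>\<in>pair_partitions (A - B). \<Prod>B\<in>\<pi>. W B)) =
     (\<Sum>(B, \<pi>) \<in> (SIGMA B:{B. B \<subseteq> A \<and> card B = 2}. pair_partitions (A - B)). W B * (\<Prod>B\<in>\<pi>. W B))"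
    using assms finB by (simp add: sum_distrib_left sum.Sigma finite_pair_partitions)
  also have "\<dots> = (\<Sum>(\<pi>, B) \<in> (SIGMA \<pi>:pair_partitions A. \<pi>). \<Prod>B\<in>\<pi>. W B)"
  proof (rule sum.reindex_bij_witness[where j = "\<lambda>(B, \<pi>). (insert B \<pi>, B)" and i = "\<lambda>(\<pi>, B). (B, \<pi> - {B})"])
    fix p assume "p \<in> (SIGMA B:{B. B \<subseteq> A \<and> card B = 2}. pair_partitions (A - B))"
    then obtain B \<pi> where p: "p = (B, \<pi>)" and h: "B \<subseteq> A" "card B = 2" "\<pi> \<in> pair_partitions (A - B)"
      by blast
    have ne: "B \<noteq> {}" using h by auto
    have notin: "B \<notin> \<pi>"
      using h ne by (auto simp: pair_partitions_def partition_on_def)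
    have "insert B \<pi> \<in> pair_partitions A"
      using h ne unfolding pair_partitions_def mem_Collect_eq
      by (subst partition_on_insert) (auto simp: disjnt_def partition_on_def)
    moreover have "finite \<pi>"
      using h assms finite_elements[of "A - B" \<pi>] by (auto simp: pair_partitions_def)
    ultimately show "(case case p of (B, \<pi>) \<Rightarrow> (insert B \<pi>, B) of (\<pi>, B) \<Rightarrow> (B, \<pi> - {B})) = p"
      "(case p of (B, \<pi>) \<Rightarrow> (insert B \<pi>, B)) \<in> (SIGMA \<pi>:pair_partitions A. \<pi>)"
      "(case case p of (B, \<pi>) \<Rightarrow> (insert B \<pi>, B) of (\<pi>, B) \<Rightarrow> \<Prod>B\<in>\<pi>. W B) =
       (case p of (B, \<pi>) \<Rightarrow> W B * (\<Prod>B\<in>\<pi>. W B))"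
      using notin p by auto
  next
    fix q assume "q \<in> (SIGMA \<pi>:pair_partitions A. \<pi>)"
    then obtain \<pi> B where q: "q = (\<pi>, B)" and h: "\<pi> \<in> pair_partitions A" "B \<in> \<pi>"
      by blast
    have "B \<subseteq> A" "card B = 2" using h by (auto simp: pair_partitions_def partition_on_def)
    moreover have "disjnt B (\<Union>(\<pi> - {B}))"
      using h by (auto simp: pair_partitions_def partition_on_def disjnt_def disjoint_def)
    then have "partition_on (A - B) (\<pi> - {B})"
      using h partition_on_insert[of B "\<pi> - {B}" A]
      by (auto simp: pair_partitions_def insert_absorb)
    then have "\<pi> - {B} \<in> pair_partitions (A - B)"
      using h by (auto simp: pair_partitions_def)
    ultimately show "(case case q of (\<pi>, B) \<Rightarrow> (B, \<pi> - {B}) of (B, \<pi>) \<Rightarrow> (insert B \<pi>, B)) = q"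
      "(case q of (\<pi>, B) \<Rightarrow> (B, \<pi> - {B})) \<in>
        (SIGMA B:{B. B \<subseteq> A \<and> card B = 2}. pair_partitions (A - B))"
      using q h by auto
  qed
  also have "\<dots> = (\<Sum>\<pi>\<in>pair_partitions A. real (card \<pi>) * (\<Prod>B\<in>\<pi>. W B))"
    using assms fin by (subst sum.Sigma[symmetric]) (auto simp: finite_pair_partitions)
  finally show ?thesis .
qed

text \<open>
  Cutting a list into consecutive pairs yields a pairing, and every pairing arises from \<open>2\<^sup>n n!\<close> lists,
  by ordering the blocks and the two elements of each block. The induction removes the first
  pair: the factor 2 comes from the order of its elements, and the factor \<open>n + 1\<close> from the choice of the
  block that comes first.
\<close>

lemma sum_permutations_pair_prod:
  fixes A :: "'a::linorder set"
  assumes "finite A" "card A = 2 * n" and sym: "\<And>x y. C x y = C y x"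
  shows "(\<Sum>xs\<in>permutations_of_set A. pair_prod C xs) =
         2 ^ n * fact n * (\<Sum>\<pi>\<in>pair_partitions A. \<Prod>B\<in>\<pi>. C (Min B) (Max B))"
  using assms(1,2)
proof (induction n arbitrary: A)
  case 0
  then show ?case by (simp add: pair_partitions_empty)
next
  case (Suc n)
  let ?H = "\<lambda>A. \<Sum>\<pi>\<in>pair_partitions A. \<Prod>B\<in>\<pi>. C (Min B) (Max B)"
  have "(\<Sum>xs\<in>permutations_of_set A. pair_prod C xs) =
    (\<Sum>x\<in>A. \<Sum>y\<in>A - {x}. C x y * (\<Sum>xs\<in>permutations_of_set (A - {x, y}). pair_prod C xs))"
  proof -
    have "A - {x} \<noteq> {}" for x
    proof
      assume "A - {x} = {}"
      then have "card A \<le> card {x}" by (intro card_mono) auto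
      then show False using Suc.prems by simp
    qed
    moreover have "A \<noteq> {}" using Suc.prems by auto
    moreover have "A - {x} - {y} = A - {x, y}" for x y by auto
    ultimately show ?thesis
      using Suc.prems by (simp add: sum_permutations_of_set_Cons sum_distrib_left)
  qed
  also have "\<dots> = (\<Sum>x\<in>A. \<Sum>y\<in>A - {x}. C x y * (2 ^ n * fact n * ?H (A - {x, y})))"
    using Suc.prems by (intro sum.cong refl arg_cong2[of _ _ _ _ "(*)"] Suc.IH)
      (auto simp: card_Diff_subset)
  also have "\<dots> = 2 * (\<Sum>B | B \<subseteq> A \<and> card B = 2.
      C (Min B) (Max B) * (2 ^ n * fact n * ?H (A - {Min B, Max B})))"
    using Suc.prems by (intro sum_ordered_pairs) (auto simp: sym insert_commute)
  also have "\<dots> = 2 * (\<Sum>B | B \<subseteq> A \<and> card B = 2.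
      2 ^ n * fact n * (C (Min B) (Max B) * ?H (A - B)))"
    by (intro arg_cong[of _ _ "(*) 2"] sum.cong refl)
       (simp add: card_2_Min_Max[THEN conjunct1, symmetric] mult.left_commute)
  also have "\<dots> = 2 * 2 ^ n * fact n * (\<Sum>\<pi>\<in>pair_partitions A.
      real (card \<pi>) * (\<Prod>B\<in>\<pi>. C (Min B) (Max B)))"
    using Suc.prems sum_pair_partitions_remove[of A "\<lambda>B. C (Min B) (Max B)"]
    by (simp flip: sum_distrib_left)
  also have "(\<Sum>\<pi>\<in>pair_partitions A. real (card \<pi>) * (\<Prod>B\<in>\<pi>. C (Min B) (Max B))) =
      real (Suc n) * ?H A"
    unfolding sum_distrib_left
    by (intro sum.cong refl) (use Suc.prems card_pair_partition[of A] in auto)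
  finally show ?case by (simp add: algebra_simps)
qed

lemma gaussian_rv_integrable_power:
  assumes "prob_space P" "gaussian_rv P Z"
  shows "integrable P (\<lambda>\<omega>. Z \<omega> ^ m)"
proof -
  interpret prob_space P by fact
  have [measurable]: "Z \<in> borel_measurable P" using assms by (simp add: gaussian_rv_def)
  consider \<mu> \<sigma> where "\<sigma> > 0" "distributed P lborel Z (normal_density \<mu> \<sigma>)"
    | \<mu> where "AE \<omega> in P. Z \<omega> = \<mu>"
    using assms by (auto simp: gaussian_rv_def)
  then show ?thesis
  proof cases
    case 1
    have "integrable P (\<lambda>\<omega>. (Z \<omega> - \<mu>) ^ k)" for k
      using distributed_integrable[OF 1(2), of "\<lambda>x. (x - \<mu>) ^ k"] integrable_normal_moment[OF 1(1)]
      by simp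
    then have "integrable P (\<lambda>\<omega>. \<Sum>k\<le>m. real (m choose k) * (Z \<omega> - \<mu>) ^ k * \<mu> ^ (m - k))"
      by auto
    moreover have "Z \<omega> ^ m = (\<Sum>k\<le>m. real (m choose k) * (Z \<omega> - \<mu>) ^ k * \<mu> ^ (m - k))" for \<omega>
      using binomial_ring[of "Z \<omega> - \<mu>" \<mu> m] by simp
    ultimately show ?thesis by simp
  next
    case 2
    then have "AE \<omega> in P. \<mu> ^ m = Z \<omega> ^ m" by eventually_elim simp
    then show ?thesis
      by (rule integrable_cong_AE_imp[rotated 2]) auto
  qed
qed

text \<open>
  A centred point mass is the case of variance 0, where both sides vanish unless \<open>n = 0\<close>.
\<close>

lemma centred_gaussian_even_moment:
  assumes "prob_space P" "gaussian_rv P Z" "integral\<^sup>L P Z = 0"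
  shows "(\<integral>\<omega>. Z \<omega> ^ (2 * n) \<partial>P) = fact (2 * n) / (2 ^ n * fact n) * (\<integral>\<omega>. (Z \<omega>)\<^sup>2 \<partial>P) ^ n"
proof -
  interpret prob_space P by fact
  have [measurable]: "Z \<in> borel_measurable P" using assms by (simp add: gaussian_rv_def)
  consider \<mu> \<sigma> where "\<sigma> > 0" "distributed P lborel Z (normal_density \<mu> \<sigma>)"
    | \<mu> where "AE \<omega> in P. Z \<omega> = \<mu>"
    using assms by (auto simp: gaussian_rv_def)
  then show ?thesis
  proof cases
    case 1
    then have [simp]: "\<mu> = 0" using assms normal_distributed_expectation by metis
    have mom: "(\<integral>\<omega>. Z \<omega> ^ (2 * k) \<partial>P) = fact (2 * k) / ((2 / \<sigma>\<^sup>2) ^ k * fact k)" for k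
      using distributed_integral[OF 1(2), of "\<lambda>x. x ^ (2 * k)"] 
        integral_normal_moment_even[OF 1(1), of 0 k] by simp
    have "(\<integral>\<omega>. (Z \<omega>)\<^sup>2 \<partial>P) = \<sigma>\<^sup>2"
      using mom[of 1] \<open>\<sigma> > 0\<close> by simp
    then show ?thesis unfolding mom by (simp add: power_divide)
  next
    case 2
    then have "integral\<^sup>L P Z = (\<integral>\<omega>. \<mu> \<partial>P)" by (intro integral_cong_AE) auto
    then have "\<mu> = 0" using assms by (simp add: prob_space)
    have mom: "(\<integral>\<omega>. Z \<omega> ^ k \<partial>P) = (\<integral>\<omega>. 0 ^ k \<partial>P)" for k
      using 2 \<open>\<mu> = 0\<close> by (intro integral_cong_AE) auto
    show ?thesis unfolding mom by (cases "n = 0") (auto simp: prob_space power_0_left)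
  qed
qed

text \<open>
  Polarization turns the expectation into an alternating sum of moments of the variables
  \<open>\<Sum>i\<in>T. Z i\<close>, which depend only on their variances \<open>\<Sum>i\<in>T. \<Sum>j\<in>T. C i j\<close>. Polarization
  in the other direction then recovers a sum over lists of products of covariances, where every
  pairing occurs \<open>2\<^sup>n n!\<close> times; this cancels against the constant in the Gaussian moments.
\<close>

theorem wick_formula:
  fixes Z :: "'a::linorder \<Rightarrow> 'w \<Rightarrow> real"
  assumes P: "prob_space P" and A: "finite A" "card A = 2 * n"
    and gauss: "\<And>T. T \<subseteq> A \<Longrightarrow> gaussian_rv P (\<lambda>\<omega>. \<Sum>i\<in>T. Z i \<omega>)"
    and centred: "\<And>i. i \<in> A \<Longrightarrow> integral\<^sup>L P (Z i) = 0"
  shows "integrable P (\<lambda>\<omega>. \<Prod>i\<in>A. Z i \<omega>)"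
    and "(\<integral>\<omega>. (\<Prod>i\<in>A. Z i \<omega>) \<partial>P) =
         (\<Sum>\<pi>\<in>pair_partitions A. \<Prod>B\<in>\<pi>. \<integral>\<omega>. Z (Min B) \<omega> * Z (Max B) \<omega> \<partial>P)"
proof -
  interpret prob_space P by fact
  define C where "C i j = (\<integral>\<omega>. Z i \<omega> * Z j \<omega> \<partial>P)" for i j
  have int: "integrable P (\<lambda>\<omega>. (\<Sum>i\<in>T. Z i \<omega>) ^ m)" if "T \<subseteq> A" for T m
    by (rule gaussian_rv_integrable_power[OF P gauss[OF that]])
  then have int_term: "integrable P (\<lambda>\<omega>. (-1) ^ (card A - card T) * (\<Sum>i\<in>T. Z i \<omega>) ^ card A)"
    if "T \<in> Pow A" for T using that by auto
  show "integrable P (\<lambda>\<omega>. \<Prod>i\<in>A. Z i \<omega>)"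
    unfolding prod_via_powers_of_sums[OF A(1)] using int_term
    by (intro integrable_divide Bochner_Integration.integrable_sum) auto
  have intZ: "integrable P (Z i)" "integrable P (\<lambda>\<omega>. (Z i \<omega>)\<^sup>2)" if "i \<in> A" for i
    using int[of "{i}" 1] int[of "{i}" 2] that by auto
  have intZZ: "integrable P (\<lambda>\<omega>. Z i \<omega> * Z j \<omega>)" if "i \<in> A" "j \<in> A" for i j
  proof (rule Bochner_Integration.integrable_bound)
    show "integrable P (\<lambda>\<omega>. (Z i \<omega>)\<^sup>2 + (Z j \<omega>)\<^sup>2)" using intZ that by auto
    show "(\<lambda>\<omega>. Z i \<omega> * Z j \<omega>) \<in> borel_measurable P"
      using intZ(1)[OF that(1)] intZ(1)[OF that(2)] by auto
    have "\<bar>x * y\<bar> \<le> x\<^sup>2 + y\<^sup>2" for x y :: real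
      using sum_squares_bound[of "\<bar>x\<bar>" "\<bar>y\<bar>"] mult_nonneg_nonneg[of "\<bar>x\<bar>" "\<bar>y\<bar>"]
      unfolding abs_mult power2_abs by linarith
    then show "AE \<omega> in P. norm (Z i \<omega> * Z j \<omega>) \<le> norm ((Z i \<omega>)\<^sup>2 + (Z j \<omega>)\<^sup>2)" by simp
  qed
  have mean: "(\<integral>\<omega>. (\<Sum>i\<in>T. Z i \<omega>) \<partial>P) = 0" if "T \<subseteq> A" for T
    using that intZ centred by (subst Bochner_Integration.integral_sum) (auto simp: subset_eq)
  have var: "(\<integral>\<omega>. (\<Sum>i\<in>T. Z i \<omega>)\<^sup>2 \<partial>P) = (\<Sum>i\<in>T. \<Sum>j\<in>T. C i j)" if "T \<subseteq> A" for T
  proof -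
    have "(\<integral>\<omega>. (\<Sum>i\<in>T. Z i \<omega>)\<^sup>2 \<partial>P) = (\<integral>\<omega>. (\<Sum>i\<in>T. \<Sum>j\<in>T. Z i \<omega> * Z j \<omega>) \<partial>P)"
      by (simp add: power2_eq_square sum_product)
    also have "\<dots> = (\<Sum>i\<in>T. \<Sum>j\<in>T. C i j)"
      using that intZZ unfolding C_def
      by (subst Bochner_Integration.integral_sum; (auto simp: subset_eq)[1])+
    finally show ?thesis .
  qed
  have "(\<integral>\<omega>. (\<Prod>i\<in>A. Z i \<omega>) \<partial>P) =
     (\<Sum>T\<in>Pow A. (-1) ^ (card A - card T) * (\<integral>\<omega>. (\<Sum>i\<in>T. Z i \<omega>) ^ card A \<partial>P)) / fact (card A)"
    unfolding prod_via_powers_of_sums[OF A(1)]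
    using int_term by (simp add: Bochner_Integration.integral_sum)
  also have "\<dots> = (\<Sum>T\<in>Pow A. (-1) ^ (card A - card T) * (\<Sum>i\<in>T. \<Sum>j\<in>T. C i j) ^ n) / (2 ^ n * fact n)"
  proof -
    have "(\<integral>\<omega>. (\<Sum>i\<in>T. Z i \<omega>) ^ card A \<partial>P) =
        fact (card A) / (2 ^ n * fact n) * (\<Sum>i\<in>T. \<Sum>j\<in>T. C i j) ^ n" if "T \<in> Pow A" for T
      using centred_gaussian_even_moment[OF P gauss mean, of T] that var[of T] A(2) by simp
    then show ?thesis
      unfolding sum_divide_distrib by (intro sum.cong refl) (simp add: field_simps)
  qed
  also have "\<dots> = (\<Sum>xs\<in>permutations_of_set A. pair_prod C xs) / (2 ^ n * fact n)"
    unfolding sum_permutations_of_set_polarization[OF A(1)] A(2)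
    using A(1) by (intro arg_cong2[of _ _ _ _ "(/)"] sum.cong refl)
      (auto simp: power_double_sum_eq_sum_lists finite_subset)
  also have "\<dots> = (\<Sum>\<pi>\<in>pair_partitions A. \<Prod>B\<in>\<pi>. C (Min B) (Max B))"
    by (subst sum_permutations_pair_prod[OF A]) (auto simp: C_def mult.commute)
  finally show "(\<integral>\<omega>. (\<Prod>i\<in>A. Z i \<omega>) \<partial>P) =
         (\<Sum>\<pi>\<in>pair_partitions A. \<Prod>B\<in>\<pi>. \<integral>\<omega>. Z (Min B) \<omega> * Z (Max B) \<omega> \<partial>P)"
    by (simp add: C_def)
qed

section \<open>Products of traces as sums over index functions\<close>

lemma sum_PiE_insert:
  fixes F :: "('a \<Rightarrow> 'b) \<Rightarrow> 'c::comm_monoid_add"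
  assumes "x \<notin> S"
  shows "(\<Sum>\<iota>\<in>PiE (insert x S) T. F \<iota>) = (\<Sum>y\<in>T x. \<Sum>\<iota>\<in>PiE S T. F (\<iota>(x := y)))"
proof -
  have "(\<Sum>\<iota>\<in>PiE (insert x S) T. F \<iota>) = (\<Sum>(y, \<iota>)\<in>T x \<times> PiE S T. F (\<iota>(x := y)))"
    unfolding PiE_insert_eq
    by (subst sum.reindex[OF inj_combinator[OF assms]]) (simp add: comp_def case_prod_unfold)
  then show ?thesis by (simp add: sum.cartesian_product)
qed

lemma sum_PiE_Un_disjoint:
  fixes F G :: "('a \<Rightarrow> 'b) \<Rightarrow> real"
  assumes "A \<inter> B = {}"
    and "\<And>\<iota> \<kappa>. (\<And>x. x \<in> A \<Longrightarrow> \<iota> x = \<kappa> x) \<Longrightarrow> F \<iota> = F \<kappa>"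
    and "\<And>\<iota> \<kappa>. (\<And>x. x \<in> B \<Longrightarrow> \<iota> x = \<kappa> x) \<Longrightarrow> G \<iota> = G \<kappa>"
  shows "(\<Sum>\<iota>\<in>PiE A T. F \<iota>) * (\<Sum>\<iota>\<in>PiE B T. G \<iota>) = (\<Sum>\<iota>\<in>PiE (A \<union> B) T. F \<iota> * G \<iota>)"
proof -
  have "(\<Sum>\<iota>\<in>PiE (A \<union> B) T. F \<iota> * G \<iota>) = (\<Sum>(\<iota>, \<kappa>)\<in>PiE A T \<times> PiE B T. F \<iota> * G \<kappa>)"
  proof (rule sum.reindex_bij_witness[where j = "\<lambda>\<iota>. (restrict \<iota> A, restrict \<iota> B)"
        and i = "\<lambda>(\<iota>, \<kappa>) x. if x \<in> A then \<iota> x else \<kappa> x"])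
    fix \<iota> assume \<iota>: "\<iota> \<in> PiE (A \<union> B) T"
    show "(case (restrict \<iota> A, restrict \<iota> B) of (\<iota>, \<kappa>) \<Rightarrow> \<lambda>x. if x \<in> A then \<iota> x else \<kappa> x) = \<iota>"
      using PiE_arb[OF \<iota>] by fastforce
    show "(restrict \<iota> A, restrict \<iota> B) \<in> PiE A T \<times> PiE B T" using \<iota> by auto
    have "F (restrict \<iota> A) = F \<iota>" "G (restrict \<iota> B) = G \<iota>"
      by (rule assms; simp)+
    then show "(case (restrict \<iota> A, restrict \<iota> B) of (\<iota>, \<kappa>) \<Rightarrow> F \<iota> * G \<kappa>) = F \<iota> * G \<iota>" by simp
  next
    fix p assume p: "p \<in> PiE A T \<times> PiE B T"
    then obtain \<iota> \<kappa> where [simp]: "p = (\<iota>, \<kappa>)" and i: "\<iota> \<in> PiE A T" and k: "\<kappa> \<in> PiE B T" by blast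
    have "restrict (\<lambda>x. if x \<in> A then \<iota> x else \<kappa> x) A = \<iota>"
      using PiE_arb[OF i] by fastforce
    moreover have "restrict (\<lambda>x. if x \<in> A then \<iota> x else \<kappa> x) B = \<kappa>"
      using PiE_arb[OF k] assms(1) by fastforce
    ultimately show "(restrict (case p of (\<iota>, \<kappa>) \<Rightarrow> \<lambda>x. if x \<in> A then \<iota> x else \<kappa> x) A,
        restrict (case p of (\<iota>, \<kappa>) \<Rightarrow> \<lambda>x. if x \<in> A then \<iota> x else \<kappa> x) B) = p" by simp
    show "(case p of (\<iota>, \<kappa>) \<Rightarrow> \<lambda>x. if x \<in> A then \<iota> x else \<kappa> x) \<in> PiE (A \<union> B) T"
      using i k by (auto simp: PiE_iff extensional_def)
  qed
  then show ?thesis by (simp add: sum_product sum.cartesian_product)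
qed

lemma prod_sum_PiE_disjoint:
  fixes F :: "'k \<Rightarrow> ('a \<Rightarrow> 'b) \<Rightarrow> real"
  assumes "finite K"
    and "\<And>k l. k \<in> K \<Longrightarrow> l \<in> K \<Longrightarrow> k \<noteq> l \<Longrightarrow> S k \<inter> S l = {}"
    and "\<And>k \<iota> \<kappa>. k \<in> K \<Longrightarrow> (\<And>x. x \<in> S k \<Longrightarrow> \<iota> x = \<kappa> x) \<Longrightarrow> F k \<iota> = F k \<kappa>"
  shows "(\<Prod>k\<in>K. \<Sum>\<iota>\<in>PiE (S k) T. F k \<iota>) = (\<Sum>\<iota>\<in>PiE (\<Union>k\<in>K. S k) T. \<Prod>k\<in>K. F k \<iota>)"
  using assms
proof (induction K)
  case empty
  then show ?case by simp
next
  case (insert k K)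
  have "(\<Prod>k\<in>insert k K. \<Sum>\<iota>\<in>PiE (S k) T. F k \<iota>) =
        (\<Sum>\<iota>\<in>PiE (S k) T. F k \<iota>) * (\<Sum>\<iota>\<in>PiE (\<Union>k\<in>K. S k) T. \<Prod>k\<in>K. F k \<iota>)"
  proof -
    have "(\<Prod>k\<in>K. \<Sum>\<iota>\<in>PiE (S k) T. F k \<iota>) = (\<Sum>\<iota>\<in>PiE (\<Union>k\<in>K. S k) T. \<Prod>k\<in>K. F k \<iota>)"
      by (rule insert.IH) (use insert.prems in blast)+
    then show ?thesis using insert.hyps by simp
  qed
  also have "\<dots> = (\<Sum>\<iota>\<in>PiE (S k \<union> (\<Union>k\<in>K. S k)) T. F k \<iota> * (\<Prod>k\<in>K. F k \<iota>))"
  proof (rule sum_PiE_Un_disjoint)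
    show "S k \<inter> (\<Union>k\<in>K. S k) = {}" using insert.prems(1) insert.hyps by blast
    show "F k \<iota> = F k \<kappa>" if "\<And>x. x \<in> S k \<Longrightarrow> \<iota> x = \<kappa> x" for \<iota> \<kappa>
      using insert.prems(2) that by blast
    show "(\<Prod>k\<in>K. F k \<iota>) = (\<Prod>k\<in>K. F k \<kappa>)" if "\<And>x. x \<in> (\<Union>k\<in>K. S k) \<Longrightarrow> \<iota> x = \<kappa> x" for \<iota> \<kappa>
      using insert.prems(2) that by (intro prod.cong refl) blast
  qed
  finally show ?case using insert.hyps by simp
qed

text \<open>
  The list runs once through a cycle of \<open>\<sigma>\<close>. Only the values of \<open>\<sigma>\<close> on the list matter,
  so that \<open>\<sigma>\<close> may be a successor function that is not a permutation.
\<close>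

definition cycle_list :: "('a \<Rightarrow> 'a) \<Rightarrow> 'a list \<Rightarrow> bool" where
  "cycle_list \<sigma> xs \<longleftrightarrow> xs \<noteq> [] \<and> distinct xs \<and> successively (\<lambda>x y. y = \<sigma> x) xs \<and> \<sigma> (last xs) = hd xs"

text \<open>
  The contribution of one choice of inner indices to an entry of a matrix product. The outer
  indices \<open>a\<close> and \<open>b\<close> are separate arguments because the entry is first computed for an open walk;
  the trace closes it by setting both to the value of \<open>\<iota>\<close> at the head of the list.
\<close>

fun walk_weight :: "('a \<Rightarrow> real mat) \<Rightarrow> ('a \<Rightarrow> nat) \<Rightarrow> nat \<Rightarrow> nat \<Rightarrow> 'a list \<Rightarrow> real" where
  "walk_weight B \<iota> a b [] = 1"
| "walk_weight B \<iota> a b [x] = B x $$ (a, b)"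
| "walk_weight B \<iota> a b (x # y # xs) = B x $$ (a, \<iota> y) * walk_weight B \<iota> (\<iota> y) b (y # xs)"

lemma walk_weight_cong:
  "(\<And>x. x \<in> set (tl xs) \<Longrightarrow> \<iota> x = \<kappa> x) \<Longrightarrow> walk_weight B \<iota> a b xs = walk_weight B \<kappa> a b xs"
  by (induction B \<iota> a b xs rule: walk_weight.induct) auto

lemma walk_weight_eq_prod:
  assumes "xs \<noteq> []" "distinct xs" "successively (\<lambda>x y. y = \<sigma> x) xs"
    "a = \<iota> (hd xs)" "b = \<iota> (\<sigma> (last xs))"
  shows "walk_weight B \<iota> a b xs = (\<Prod>x\<in>set xs. B x $$ (\<iota> x, \<iota> (\<sigma> x)))"
  using assms by (induction B \<iota> a b xs rule: walk_weight.induct) auto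

lemma mat_list_prod_carrier:
  assumes "xs \<noteq> []" "successively (\<lambda>x y. y = \<sigma> x) xs"
    "\<And>x. x \<in> set xs \<Longrightarrow> B x \<in> carrier_mat (d x) (d (\<sigma> x))"
  shows "mat_list_prod (map B xs) \<in> carrier_mat (d (hd xs)) (d (\<sigma> (last xs)))"
  using assms
proof (induction xs rule: induct_list012)
  case (3 x y zs)
  then show ?case by (auto intro!: mult_carrier_mat[of _ _ "d y"])
qed auto

lemma mat_list_prod_entry:
  assumes "xs \<noteq> []" "distinct xs" "successively (\<lambda>x y. y = \<sigma> x) xs"
    "\<And>x. x \<in> set xs \<Longrightarrow> B x \<in> carrier_mat (d x) (d (\<sigma> x))"
    "a < d (hd xs)" "b < d (\<sigma> (last xs))"
  shows "mat_list_prod (map B xs) $$ (a, b) =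
         (\<Sum>\<iota>\<in>PiE (set (tl xs)) (\<lambda>x. {..<d x}). walk_weight B \<iota> a b xs)"
  using assms
proof (induction xs arbitrary: a rule: induct_list012)
  case (3 x y zs)
  let ?M = "mat_list_prod (map B (y # zs))" and ?T = "\<lambda>x. {..<d x}"
  have B: "B x \<in> carrier_mat (d x) (d y)" using "3.prems" by auto
  have M: "?M \<in> carrier_mat (d y) (d (\<sigma> (last (y # zs))))"
  proof -
    have "successively (\<lambda>x y. y = \<sigma> x) (y # zs)" using "3.prems"(3)
      by (rule successively.simps(3)[THEN iffD1, THEN conjunct2])
    from mat_list_prod_carrier[of "y # zs" \<sigma> B d, OF _ this] "3.prems"(4)
    show ?thesis by simp
  qed
  have y: "y \<notin> set zs" using "3.prems" by simp
  have "mat_list_prod (map B (x # y # zs)) $$ (a, b) = (\<Sum>i<d y. B x $$ (a, i) * ?M $$ (i, b))"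
    using carrier_matD[OF B] carrier_matD[OF M] "3.prems"(5,6)
    by (simp add: scalar_prod_def atLeast0LessThan)
  also have "\<dots> = (\<Sum>i<d y. B x $$ (a, i) * (\<Sum>\<iota>\<in>PiE (set zs) ?T. walk_weight B \<iota> i b (y # zs)))"
    using "3.prems" by (intro sum.cong refl arg_cong2[of _ _ _ _ "(*)"]) (subst "3.IH"(2), auto)
  also have "\<dots> = (\<Sum>i<d y. \<Sum>\<iota>\<in>PiE (set zs) ?T. walk_weight B (\<iota>(y := i)) a b (x # y # zs))"
  proof -
    have "walk_weight B (\<iota>(y := i)) i b (y # zs) = walk_weight B \<iota> i b (y # zs)" for \<iota> i
      by (rule walk_weight_cong) (use y in auto)
    then show ?thesis by (simp add: sum_distrib_left)
  qed
  also have "\<dots> = (\<Sum>\<iota>\<in>PiE (insert y (set zs)) ?T. walk_weight B \<iota> a b (x # y # zs))"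
    by (rule sum_PiE_insert[OF y, symmetric])
  finally show ?case by simp
qed auto

lemma mat_trace_cycle_list:
  assumes xs: "cycle_list \<sigma> xs"
    and B: "\<And>x. x \<in> set xs \<Longrightarrow> B x \<in> carrier_mat (d x) (d (\<sigma> x))"
  shows "mat_trace (mat_list_prod (map B xs)) =
         (\<Sum>\<iota>\<in>PiE (set xs) (\<lambda>x. {..<d x}). \<Prod>x\<in>set xs. B x $$ (\<iota> x, \<iota> (\<sigma> x)))"
proof -
  have c: "xs \<noteq> []" "distinct xs" "successively (\<lambda>x y. y = \<sigma> x) xs" "\<sigma> (last xs) = hd xs"
    using xs by (auto simp: cycle_list_def)
  let ?T = "\<lambda>x. {..<d x}"
  have hd: "hd xs \<notin> set (tl xs)" "set xs = insert (hd xs) (set (tl xs))"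
    using c by (cases xs; auto)+
  have "mat_trace (mat_list_prod (map B xs)) = (\<Sum>a<d (hd xs). mat_list_prod (map B xs) $$ (a, a))"
    using mat_list_prod_carrier[of xs \<sigma> B d, OF c(1,3) B] by (simp add: mat_trace_def)
  also have "\<dots> = (\<Sum>a<d (hd xs). \<Sum>\<iota>\<in>PiE (set (tl xs)) ?T. walk_weight B \<iota> a a xs)"
    using c B by (intro sum.cong refl mat_list_prod_entry[where \<sigma> = \<sigma>]) auto
  also have "\<dots> = (\<Sum>a<d (hd xs). \<Sum>\<iota>\<in>PiE (set (tl xs)) ?T.
      walk_weight B (\<iota>(hd xs := a)) ((\<iota>(hd xs := a)) (hd xs)) ((\<iota>(hd xs := a)) (hd xs)) xs)"
    using hd by (intro sum.cong refl) (auto intro!: walk_weight_cong)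
  also have "\<dots> = (\<Sum>\<iota>\<in>PiE (set xs) ?T. walk_weight B \<iota> (\<iota> (hd xs)) (\<iota> (hd xs)) xs)"
    unfolding hd(2) by (rule sum_PiE_insert[OF hd(1), symmetric])
  also have "\<dots> = (\<Sum>\<iota>\<in>PiE (set xs) ?T. \<Prod>x\<in>set xs. B x $$ (\<iota> x, \<iota> (\<sigma> x)))"
    using c by (intro sum.cong refl walk_weight_eq_prod) auto
  finally show ?thesis .
qed

lemma cycle_list_closed: "cycle_list \<sigma> xs \<Longrightarrow> x \<in> set xs \<Longrightarrow> \<sigma> x \<in> set xs"
proof -
  assume c: "cycle_list \<sigma> xs" and "x \<in> set xs"
  then obtain i where i: "i < length xs" "x = xs ! i" by (auto simp: in_set_conv_nth)
  show "\<sigma> x \<in> set xs"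
  proof (cases "Suc i < length xs")
    case True
    then have "xs ! Suc i = \<sigma> x"
      using c i by (auto simp: cycle_list_def successively_conv_nth)
    then show ?thesis using True by (metis nth_mem)
  next
    case False
    then have "x = last xs" using i by (cases "xs = []") (auto simp: last_conv_nth not_less le_Suc_eq)
    then show ?thesis using c by (auto simp: cycle_list_def)
  qed
qed

text \<open>
  Every matrix owns its row index \<open>\<iota> x\<close>, and its column index is the row index of the next matrix
  along the cycle. Both \<open>Y\<^sub>1 \<cdots> Y\<^sub>r\<close> and the traces along \<open>\<sigma>/2\<close> are expanded by this formula.
\<close>

theorem prod_mat_trace_cycle_lists:
  assumes K: "finite K"
    and L: "\<And>k. k \<in> K \<Longrightarrow> cycle_list \<sigma> (L k)"
    and disj: "\<And>k l. k \<in> K \<Longrightarrow> l \<in> K \<Longrightarrow> k \<noteq> l \<Longrightarrow> set (L k) \<inter> set (L l) = {}"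
    and S: "S = (\<Union>k\<in>K. set (L k))"
    and B: "\<And>x. x \<in> S \<Longrightarrow> B x \<in> carrier_mat (d x) (d (\<sigma> x))"
  shows "(\<Prod>k\<in>K. mat_trace (mat_list_prod (map B (L k)))) =
         (\<Sum>\<iota>\<in>PiE S (\<lambda>x. {..<d x}). \<Prod>x\<in>S. B x $$ (\<iota> x, \<iota> (\<sigma> x)))"
proof -
  let ?F = "\<lambda>k \<iota>. \<Prod>x\<in>set (L k). B x $$ (\<iota> x, \<iota> (\<sigma> x))"
  have "(\<Prod>k\<in>K. mat_trace (mat_list_prod (map B (L k)))) =
        (\<Prod>k\<in>K. \<Sum>\<iota>\<in>PiE (set (L k)) (\<lambda>x. {..<d x}). ?F k \<iota>)"
    using L B S by (intro prod.cong refl mat_trace_cycle_list) auto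
  also have "\<dots> = (\<Sum>\<iota>\<in>PiE S (\<lambda>x. {..<d x}). \<Prod>k\<in>K. ?F k \<iota>)"
    unfolding S using K disj cycle_list_closed[OF L]
    by (intro prod_sum_PiE_disjoint prod.cong refl) auto
  also have "\<dots> = (\<Sum>\<iota>\<in>PiE S (\<lambda>x. {..<d x}). \<Prod>x\<in>S. B x $$ (\<iota> x, \<iota> (\<sigma> x)))"
    unfolding S using K disj by (intro sum.cong refl prod.UNION_disjoint[symmetric]) auto
  finally show ?thesis .
qed

lemma cycle_list_support:
  assumes "permutation p"
  shows "cycle_list p (support p x)"
proof -
  let ?m = "least_power p x"
  have m: "?m > 0" "(p ^^ ?m) x = x" using least_power_of_permutation[OF assms] by auto
  then have "last (support p x) = (p ^^ (?m - 1)) x" "hd (support p x) = x"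
    by (simp_all add: last_map hd_map)
  moreover have "p ((p ^^ (?m - 1)) x) = x"
    using m by (metis Suc_diff_1 comp_apply funpow.simps(2))
  moreover have "successively (\<lambda>x y. y = p x) (support p x)"
    by (auto simp: successively_conv_nth)
  ultimately show ?thesis
    using m cycle_of_permutation[OF assms, of x] unfolding cycle_list_def by simp
qed

lemma Tr_perm_eq_sum:
  assumes \<sigma>: "\<sigma> permutes S" and S: "finite S"
    and A: "\<And>c. c \<in> S \<Longrightarrow> signed_mat A c \<in> carrier_mat (d c) (d (\<sigma> c))"
  shows "Tr_perm S \<sigma> A =
    (\<Sum>\<iota>\<in>PiE S (\<lambda>c. {..<d c}). \<Prod>c\<in>S. signed_mat A c $$ (\<iota> c, \<iota> (\<sigma> c)))"
proof -
  have perm: "permutation \<sigma>" using \<sigma> S permutation_permutes by blast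
  have sup: "set (support \<sigma> (Min C)) = C" if C: "C \<in> orbit \<sigma> ` S" for C
  proof -
    from C obtain x where x: "x \<in> S" "C = orbit \<sigma> x" by blast
    have "x \<in> C" and "finite C"
      using x permutation_self_in_orbit[OF perm] finite_subset[OF permutes_orbit_subset[OF \<sigma>] S] by auto
    then have "Min C \<in> C" by (metis Min_in empty_iff)
    then have "C = orbit \<sigma> (Min C)"
      using x orbit_cyclic_eq3[OF cyclic_on_orbit[OF \<sigma> S]] by metis
    also have "\<dots> = set (support \<sigma> (Min C))"
      unfolding support_set[OF perm] orbit_altdef_permutation[OF perm] by auto
    finally show ?thesis ..
  qed
  have "C \<inter> C' = {}" if "C \<in> orbit \<sigma> ` S" "C' \<in> orbit \<sigma> ` S" "C \<noteq> C'" for C C'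
  proof (rule ccontr)
    assume "C \<inter> C' \<noteq> {}"
    then obtain y where "y \<in> C" "y \<in> C'" by blast
    then have "orbit \<sigma> y = C" "orbit \<sigma> y = C'"
      using that orbit_cyclic_eq3[OF cyclic_on_orbit[OF \<sigma> S]] by (metis imageE)+
    with \<open>C \<noteq> C'\<close> show False by simp
  qed
  moreover have "S = (\<Union>C\<in>orbit \<sigma> ` S. set (support \<sigma> (Min C)))"
  proof -
    have "(\<Union>C\<in>orbit \<sigma> ` S. set (support \<sigma> (Min C))) = \<Union> (orbit \<sigma> ` S)"
      using sup by auto
    also have "\<dots> = S"
      using permutation_self_in_orbit[OF perm] permutes_orbit_subset[OF \<sigma>] by blast
    finally show ?thesis ..
  qed
  ultimately show ?thesis
    unfolding Tr_perm_def using S A sup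
    by (intro prod_mat_trace_cycle_lists cycle_list_support[OF perm]) auto
qed

section \<open>The permutations \<open>\<gamma>\<^sub>+\<close> and \<open>\<gamma>\<^sub>-\<close>, and pairings\<close>

abbreviation (input) perm_inv :: "('a \<Rightarrow> 'a) \<Rightarrow> 'a \<Rightarrow> 'a" where
  "perm_inv \<equiv> inv_into UNIV"

lemma cycle_list_cong:
  assumes "cycle_list \<sigma> xs" "\<And>x. x \<in> set xs \<Longrightarrow> \<tau> x = \<sigma> x"
  shows "cycle_list \<tau> xs"
  using assms unfolding cycle_list_def
  by (auto elim!: successively_mono)

lemma cycle_list_cycle_of_list:
  assumes "xs \<noteq> []" "distinct xs"
  shows "cycle_list (cycle_of_list xs) xs"
proof -
  have rot: "map (cycle_of_list xs) xs = rotate1 xs"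
    using cyclic_rotation[OF assms(2), of 1] by simp
  have nth: "cycle_of_list xs (xs ! i) = xs ! (Suc i mod length xs)" if "i < length xs" for i
    using arg_cong[OF rot, of "\<lambda>ys. ys ! i"] that by (simp add: nth_rotate1)
  have "successively (\<lambda>x y. y = cycle_of_list xs x) xs"
    unfolding successively_conv_nth using nth by auto
  moreover have "cycle_of_list xs (last xs) = hd xs"
    using nth[of "length xs - 1"] assms(1) by (simp add: last_conv_nth hd_conv_nth)
  ultimately show ?thesis using assms by (simp add: cycle_list_def)
qed

lemma cycle_list_upto:
  assumes "cycle_list \<sigma> [a..b]" "x \<in> {a..b}"
  shows "\<sigma> x = (if x = b then a else x + 1)"
proof -
  have "a \<le> b" using assms by auto
  then have "last [a..b] = b" "hd [a..b] = a"
    by (simp_all add: last_conv_nth hd_conv_nth nth_upto)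
  then have "\<sigma> b = a" using assms by (simp add: cycle_list_def)
  moreover have "\<sigma> x = x + 1" if "x \<noteq> b"
  proof -
    define i where "i = nat (x - a)"
    have i: "Suc i < length [a..b]" and x: "x = a + int i" using assms that by (auto simp: i_def)
    have "[a..b] ! Suc i = \<sigma> ([a..b] ! i)"
      using assms(1) i by (auto simp: cycle_list_def successively_conv_nth)
    then show ?thesis using i x by (simp add: nth_upto)
  qed
  ultimately show ?thesis by simp
qed

lemma partial_sum_simps [simp]:
  "partial_sum ns 0 = 0" "partial_sum ns (Suc k) = partial_sum ns k + ns (Suc k)"
  by (simp_all add: partial_sum_def)

lemma partial_sum_mono: "k \<le> l \<Longrightarrow> partial_sum ns k \<le> partial_sum ns l"
  unfolding partial_sum_def by (rule sum_mono2) auto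

lemma set_block_list:
  "set (block_list ns k) = {2 * int (partial_sum ns (k - 1)) + 1 .. 2 * int (partial_sum ns k)}"
  by (simp add: block_list_def)

lemma block_list_subset: "k \<le> r \<Longrightarrow> set (block_list ns k) \<subseteq> {1..2 * int (partial_sum ns r)}"
  using partial_sum_mono[of k r ns] by (auto simp: set_block_list)

lemma block_list_disjoint:
  assumes "k < l"
  shows "set (block_list ns k) \<inter> set (block_list ns l) = {}"
proof -
  have "partial_sum ns k \<le> partial_sum ns (l - 1)"
    using assms by (intro partial_sum_mono) auto
  then show ?thesis by (auto simp: set_block_list)
qed

lemma UN_block_list: "(\<Union>k\<in>{1..r}. set (block_list ns k)) = {1..2 * int (partial_sum ns r)}"
proof (induction r)
  case (Suc r)
  have "{1..Suc r} = insert (Suc r) {1..r}" by auto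
  then show ?case using Suc by (auto simp: set_block_list)
qed auto

lemma gamma_plus_permutes: "gamma_plus ns r permutes {1..2 * int (partial_sum ns r)}"
proof (induction r)
  case (Suc r)
  have "gamma_plus ns r permutes {1..2 * int (partial_sum ns (Suc r))}"
    by (rule permutes_subset[OF Suc]) auto
  moreover have "cycle_of_list (block_list ns (Suc r)) permutes {1..2 * int (partial_sum ns (Suc r))}"
    by (rule permutes_subset[OF cycle_permutes block_list_subset]) simp
  ultimately show ?case
    unfolding gamma_plus.simps by (intro permutes_compose)
qed auto

lemma cycle_list_gamma_plus:
  assumes "k \<in> {1..r}" "\<And>k. k \<in> {1..r} \<Longrightarrow> ns k > 0"
  shows "cycle_list (gamma_plus ns r) (block_list ns k)"
  using assms
proof (induction r)
  case (Suc r)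
  show ?case
  proof (cases "k = Suc r")
    case True
    have ne: "block_list ns k \<noteq> []"
      using Suc.prems(2)[of k] True by (simp add: block_list_def)
    have c: "cycle_list (cycle_of_list (block_list ns k)) (block_list ns k)"
      by (rule cycle_list_cycle_of_list[OF ne]) (simp add: block_list_def)
    show ?thesis
    proof (rule cycle_list_cong[OF c])
      fix x assume "x \<in> set (block_list ns k)"
      then have "cycle_of_list (block_list ns k) x \<in> set (block_list ns k)"
        by (rule cycle_list_closed[OF c])
      then have "cycle_of_list (block_list ns k) x \<notin> {1..2 * int (partial_sum ns r)}"
        using True by (simp add: set_block_list)
      then show "gamma_plus ns (Suc r) x = cycle_of_list (block_list ns k) x"
        using gamma_plus_permutes[of ns r] True by (simp add: permutes_not_in)
    qed
  next
    case False
    then have k: "k \<in> {1..r}" using Suc.prems by auto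
    show ?thesis
    proof (rule cycle_list_cong[OF Suc.IH[OF k]])
      show "ns j > 0" if "j \<in> {1..r}" for j using Suc.prems(2)[of j] that by simp
      fix x assume "x \<in> set (block_list ns k)"
      then have "x \<notin> set (block_list ns (Suc r))"
        using block_list_disjoint[of k "Suc r" ns] k by auto
      then show "gamma_plus ns (Suc r) x = gamma_plus ns r x"
        by (simp add: id_outside_supp)
    qed
  qed
qed auto

lemma gamma_plus_parity:
  assumes "\<And>k. k \<in> {1..r} \<Longrightarrow> ns k > 0" "x \<in> {1..2 * int (partial_sum ns r)}"
  shows "even (gamma_plus ns r x) \<longleftrightarrow> odd x"
proof -
  obtain k where k: "k \<in> {1..r}" "x \<in> set (block_list ns k)"
    using assms(2) unfolding UN_block_list[symmetric] by auto
  have "gamma_plus ns r x = (if x = 2 * int (partial_sum ns k)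
      then 2 * int (partial_sum ns (k - 1)) + 1 else x + 1)"
    using cycle_list_gamma_plus[OF k(1) assms(1)] k(2) unfolding set_block_list
    by (intro cycle_list_upto) (auto simp: block_list_def)
  then show ?thesis by auto
qed

lemma gamma_minus_eq: "gamma_minus ns r = uminus \<circ> gamma_plus ns r \<circ> uminus"
proof (induction r)
  case (Suc r)
  have "cycle_of_list (map uminus (block_list ns (Suc r))) =
        uminus \<circ> cycle_of_list (block_list ns (Suc r)) \<circ> perm_inv uminus"
    by (rule conjugation_of_cycle[symmetric]) (auto simp: block_list_def bij_uminus)
  moreover have "perm_inv uminus = (uminus :: int \<Rightarrow> int)"
    by (rule inv_equality) auto
  ultimately show ?case using Suc by (simp add: fun_eq_iff)
qed (simp add: fun_eq_iff)

lemma inv_gamma_minus: "perm_inv (gamma_minus ns r) x = - perm_inv (gamma_plus ns r) (- x)"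
proof -
  have "perm_inv (gamma_minus ns r) = (\<lambda>x. - perm_inv (gamma_plus ns r) (- x))"
    by (rule inv_equality)
       (simp_all add: gamma_minus_eq permutes_inverses[OF gamma_plus_permutes])
  then show ?thesis by simp
qed

lemma pairing_perm_props:
  assumes "\<pi> \<in> pairings m" "k \<in> {1..int m}"
  shows "pairing_perm \<pi> k \<in> {1..int m}" "pairing_perm \<pi> (pairing_perm \<pi> k) = k"
    "pairing_perm \<pi> k \<noteq> k" "{nat k, nat (pairing_perm \<pi> k)} \<in> \<pi>"
proof -
  have P: "partition_on {1..m} \<pi>" and two: "\<And>B. B \<in> \<pi> \<Longrightarrow> card B = 2"
    using assms by (auto simp: pairings_def)
  have partner: "pairing_perm \<pi> (int x) = int y" if "{x, y} \<in> \<pi>" for x y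
  proof -
    have xy: "x \<in> {1..m}" using P that by (auto simp: partition_on_def)
    have "(THE l. {x, l} \<in> \<pi>) = y"
    proof (rule the_equality, rule that)
      fix l assume "{x, l} \<in> \<pi>"
      moreover have "disjoint \<pi>" using P by (simp add: partition_on_def)
      ultimately have "{x, l} = {x, y}"
        using that disjointD[of \<pi> "{x, l}" "{x, y}"] by blast
      then show "l = y" by (auto simp: doubleton_eq_iff)
    qed
    then show ?thesis using xy that by (auto simp: pairing_perm_def)
  qed
  have "nat k \<in> \<Union>\<pi>" using P assms(2) by (auto simp: partition_on_def)
  then obtain B where B: "B \<in> \<pi>" "nat k \<in> B" by auto
  then obtain y where y: "B = {nat k, y}" "y \<noteq> nat k"
    using two[of B] by (auto simp: card_2_iff)
  have k: "pairing_perm \<pi> k = int y" using partner[of "nat k" y] B y assms(2) by simp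
  have y1: "pairing_perm \<pi> (int y) = k"
    using partner[of y "nat k"] B y assms(2) by (simp add: insert_commute)
  have "y \<in> {1..m}" using B y P by (auto simp: partition_on_def)
  then show "pairing_perm \<pi> k \<in> {1..int m}" using k by auto
  show "pairing_perm \<pi> (pairing_perm \<pi> k) = k" using k y1 by simp
  show "pairing_perm \<pi> k \<noteq> k" using y assms(2) k by auto
  show "{nat k, nat (pairing_perm \<pi> k)} \<in> \<pi>" using B y k by simp
qed

lemma pairing_perm_outside:
  assumes "\<pi> \<in> pairings m" "k \<notin> {1..int m}"
  shows "pairing_perm \<pi> k = k"
  using assms by (auto simp: pairings_def partition_on_def pairing_perm_def)

section \<open>The particular cycles\<close>

text \<open>
  What is needed of \<open>\<sigma>\<close>, the permutation built from a pairing \<open>p\<close> and from \<open>\<gamma> = \<gamma>\<^sub>+\<close>, in terms of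
  the values of \<open>p\<close> and \<open>\<gamma>\<close> at positive integers only. The maps \<open>\<delta>\<close> and \<open>\<delta>'\<close> survive as the case
  distinction on parities: it tells whether two paired random factors are both transposed or both
  untransposed.
\<close>

locale pairing_premap =
  fixes m :: nat and \<gamma> p \<sigma> :: "int \<Rightarrow> int"
  assumes \<gamma>_permutes: "\<gamma> permutes {1..int m}"
    and \<gamma>_parity: "k \<in> {1..int m} \<Longrightarrow> even (\<gamma> k) \<longleftrightarrow> odd k"
    and p_in: "k \<in> {1..int m} \<Longrightarrow> p k \<in> {1..int m}"
    and p_invol: "k \<in> {1..int m} \<Longrightarrow> p (p k) = k"
    and p_neq: "k \<in> {1..int m} \<Longrightarrow> p k \<noteq> k"
    and \<sigma>_pos: "k \<in> {1..int m} \<Longrightarrow>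
      \<sigma> k = (if even (\<gamma> k) = even (p (\<gamma> k)) then - perm_inv \<gamma> (p (\<gamma> k)) else p (\<gamma> k))"
    and \<sigma>_neg: "k \<in> {1..int m} \<Longrightarrow>
      \<sigma> (- k) = (if even k = even (p k) then p k else - perm_inv \<gamma> (p k))"
    and \<sigma>_outside: "k \<notin> pm_set m \<Longrightarrow> \<sigma> k = k"
begin

lemma \<gamma>_in: "k \<in> {1..int m} \<Longrightarrow> \<gamma> k \<in> {1..int m}"
  using permutes_in_image[OF \<gamma>_permutes] by blast

lemma inv_\<gamma>_in: "k \<in> {1..int m} \<Longrightarrow> perm_inv \<gamma> k \<in> {1..int m}"
  using permutes_in_image[OF permutes_inv[OF \<gamma>_permutes]] by blast

lemma \<gamma>_inverses [simp]: "\<gamma> (perm_inv \<gamma> k) = k" "perm_inv \<gamma> (\<gamma> k) = k"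
  using permutes_inverses[OF \<gamma>_permutes] by auto

lemma inv_\<gamma>_parity: "k \<in> {1..int m} \<Longrightarrow> even (perm_inv \<gamma> k) \<longleftrightarrow> odd k"
  using \<gamma>_parity[OF inv_\<gamma>_in] by auto

lemma pm_cases:
  assumes "c \<in> pm_set m"
  obtains "c \<in> {1..int m}" | k where "c = - k" "k \<in> {1..int m}"
proof -
  consider "c > 0" | "c < 0"
    using assms by (cases c "0::int" rule: linorder_cases) (auto simp: pm_set_def)
  then show ?thesis
  proof cases
    case 1 then show ?thesis using assms that(1) by (auto simp: pm_set_def)
  next
    case 2 then show ?thesis using assms that(2)[of "- c"] by (auto simp: pm_set_def)
  qed
qed

lemma pm_setI: "k \<in> {1..int m} \<Longrightarrow> k \<in> pm_set m" "k \<in> {1..int m} \<Longrightarrow> - k \<in> pm_set m"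
  by (auto simp: pm_set_def)

lemma uminus_pm_set [simp]: "- c \<in> pm_set m \<longleftrightarrow> c \<in> pm_set m"
  by (auto simp: pm_set_def)

lemma finite_pm_set [simp]: "finite (pm_set m)"
  by (rule finite_subset[of _ "{- int m..int m}"]) (auto simp: pm_set_def)

lemma \<sigma>_in: "c \<in> pm_set m \<Longrightarrow> \<sigma> c \<in> pm_set m"
  by (erule pm_cases) (auto simp: \<sigma>_pos \<sigma>_neg intro!: pm_setI inv_\<gamma>_in p_in \<gamma>_in simp del: uminus_pm_set)

text \<open>
  Conjugation by the sign change inverts \<open>\<sigma>\<close>, which is why cycles come in pairs
  \<open>(k\<^sub>1, \<dots>, k\<^sub>m)\<close>, \<open>(-k\<^sub>m, \<dots>, -k\<^sub>1)\<close>.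
\<close>

lemma \<sigma>_reflect: "c \<in> pm_set m \<Longrightarrow> \<sigma> (- \<sigma> c) = - c"
proof (erule pm_cases)
  assume k: "c \<in> {1..int m}"
  let ?l = "p (\<gamma> c)"
  have l: "?l \<in> {1..int m}" "perm_inv \<gamma> ?l \<in> {1..int m}" "p ?l = \<gamma> c"
    using k by (simp_all only: p_in \<gamma>_in inv_\<gamma>_in p_invol)
  show ?thesis using \<sigma>_pos[OF k] \<sigma>_pos[OF l(2)] \<sigma>_neg[OF l(1)] l(3) by auto
next
  fix k assume c: "c = - k" and k: "k \<in> {1..int m}"
  have l: "p k \<in> {1..int m}" "perm_inv \<gamma> (p k) \<in> {1..int m}" "p (p k) = k"
    using k by (simp_all only: p_in inv_\<gamma>_in p_invol)
  show ?thesis unfolding c using \<sigma>_neg[OF k] \<sigma>_pos[OF l(2)] \<sigma>_neg[OF l(1)] l(3) by auto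
qed

lemma \<sigma>_neq_uminus: "c \<in> pm_set m \<Longrightarrow> \<sigma> c \<noteq> - c"
proof (erule pm_cases)
  assume k: "c \<in> {1..int m}"
  have "p (\<gamma> c) \<noteq> \<gamma> c" "p (\<gamma> c) \<in> {1..int m}" using p_neq[OF \<gamma>_in[OF k]] p_in[OF \<gamma>_in[OF k]] by auto
  moreover have "perm_inv \<gamma> (p (\<gamma> c)) \<noteq> c" using \<gamma>_inverses calculation by metis
  ultimately show ?thesis using \<sigma>_pos[OF k] k by (auto split: if_splits)
next
  fix k assume c: "c = - k" and k: "k \<in> {1..int m}"
  have "perm_inv \<gamma> (p k) > 0" using inv_\<gamma>_in[OF p_in[OF k]] by simp
  then show ?thesis unfolding c using \<sigma>_neg[OF k] k p_neq[OF k] by (auto split: if_splits)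
qed

lemma \<sigma>_parity: "c \<in> pm_set m \<Longrightarrow> even (\<sigma> c) \<longleftrightarrow> even c"
proof (erule pm_cases)
  assume k: "c \<in> {1..int m}"
  show ?thesis
    using \<sigma>_pos[OF k] \<gamma>_parity[OF k] inv_\<gamma>_parity[OF p_in[OF \<gamma>_in[OF k]]] by auto
next
  fix k assume c: "c = - k" and k: "k \<in> {1..int m}"
  show ?thesis unfolding c
    using \<sigma>_neg[OF k] inv_\<gamma>_parity[OF p_in[OF k]] by auto
qed

lemma \<sigma>_permutes: "\<sigma> permutes pm_set m"
proof (rule bij_imp_permutes)
  show "bij_betw \<sigma> (pm_set m) (pm_set m)"
    by (rule bij_betw_byWitness[where f' = "\<lambda>c. - \<sigma> (- c)"])
       (auto simp: \<sigma>_in \<sigma>_reflect)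
qed (rule \<sigma>_outside)

lemma funpow_\<sigma>_in: "c \<in> pm_set m \<Longrightarrow> (\<sigma> ^^ j) c \<in> pm_set m"
  by (induction j) (auto simp: \<sigma>_in)

lemma funpow_\<sigma>_reflect: "c \<in> pm_set m \<Longrightarrow> (\<sigma> ^^ j) (- (\<sigma> ^^ j) c) = - c"
proof (induction j)
  case (Suc j)
  have "(\<sigma> ^^ Suc j) (- (\<sigma> ^^ Suc j) c) = (\<sigma> ^^ j) (\<sigma> (- \<sigma> ((\<sigma> ^^ j) c)))"
    by (simp add: funpow_swap1)
  then show ?case using Suc by (simp add: \<sigma>_reflect funpow_\<sigma>_in)
qed simp

text \<open>
  The two cycles of such a pair are distinct. If \<open>\<sigma>\<^sup>i c = -c\<close>, then the reflection \<open>x \<mapsto> -x\<close> reverses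
  the walk from \<open>c\<close> to \<open>-c\<close>. In its middle lies either a point with \<open>x = -x\<close> (if \<open>i\<close> is even) or a
  step with \<open>\<sigma> x = -x\<close> (if \<open>i\<close> is odd), and both are impossible.
\<close>

lemma funpow_\<sigma>_neq_uminus:
  assumes c: "c \<in> pm_set m"
  shows "(\<sigma> ^^ i) c \<noteq> - c"
proof
  assume eq: "(\<sigma> ^^ i) c = - c"
  have inj: "x = y" if "(\<sigma> ^^ j) x = (\<sigma> ^^ j) y" for j x y
    using that permutes_inj[OF permutes_funpow[OF \<sigma>_permutes]] by (meson injD)
  define x where "x = (\<sigma> ^^ (i div 2)) c"
  have x: "x \<in> pm_set m" using c by (simp add: x_def funpow_\<sigma>_in)
  have "(\<sigma> ^^ (i div 2)) ((\<sigma> ^^ (i mod 2)) x) = (\<sigma> ^^ (i div 2 + i mod 2 + i div 2)) c"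
    by (simp add: x_def funpow_add)
  also have "i div 2 + i mod 2 + i div 2 = i" by presburger
  also have "(\<sigma> ^^ i) c = (\<sigma> ^^ (i div 2)) (- x)"
    unfolding eq x_def using funpow_\<sigma>_reflect[OF c] by simp
  finally have "(\<sigma> ^^ (i mod 2)) x = - x" by (rule inj)
  moreover have "x \<noteq> 0" using x by (simp add: pm_set_def)
  moreover have "i mod 2 = 0 \<or> i mod 2 = 1" by presburger
  ultimately show False using \<sigma>_neq_uminus[OF x] by auto
qed

lemma permutation_\<sigma>: "permutation \<sigma>"
  using \<sigma>_permutes finite_pm_set permutation_permutes by blast

lemma orbit_\<sigma>_eq: "y \<in> orbit \<sigma> x \<Longrightarrow> orbit \<sigma> y = orbit \<sigma> x"
  by (rule orbit_cyclic_eq3[OF cyclic_on_orbit[OF \<sigma>_permutes finite_pm_set]])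

lemma orbit_\<sigma>_uminus:
  assumes c: "c \<in> pm_set m"
  shows "orbit \<sigma> (- c) = uminus ` orbit \<sigma> c"
proof -
  have sub: "uminus ` orbit \<sigma> c \<subseteq> orbit \<sigma> (- c)" if c: "c \<in> pm_set m" for c
  proof clarify
    fix y assume "y \<in> orbit \<sigma> c"
    then obtain j where "y = (\<sigma> ^^ j) c" unfolding orbit_altdef_permutation[OF permutation_\<sigma>] by auto
    then have "- c \<in> orbit \<sigma> (- y)"
      unfolding orbit_altdef_permutation[OF permutation_\<sigma>] using funpow_\<sigma>_reflect[OF c, of j] by (metis (mono_tags) mem_Collect_eq)
    then show "- y \<in> orbit \<sigma> (- c)"
      using orbit_\<sigma>_eq permutation_self_in_orbit[OF permutation_\<sigma>] by metis
  qed
  from sub[OF c] sub[of "- c"] c show ?thesis by force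
qed

definition half :: "int set" where "half = half_dom m \<sigma>"

lemma half_subset: "half \<subseteq> pm_set m"
  by (auto simp: half_def half_dom_def)

lemma \<sigma>_in_half: "c \<in> pm_set m \<Longrightarrow> \<sigma> c \<in> half \<longleftrightarrow> c \<in> half"
  using orbit_\<sigma>_eq[OF orbit.base[of \<sigma> c]] \<sigma>_in by (auto simp: half_def half_dom_def)

text \<open>
  An element of lowest absolute value is unique in its cycle, as its negative lies in the
  opposite cycle; hence exactly one of two opposite cycles is particular.
\<close>

lemma uminus_in_half:
  assumes c: "c \<in> pm_set m"
  shows "- c \<in> half \<longleftrightarrow> c \<notin> half"
proof -
  let ?C = "orbit \<sigma> c"
  have cC: "c \<in> ?C" by (rule permutation_self_in_orbit[OF permutation_\<sigma>])
  have sub: "?C \<subseteq> pm_set m" by (rule permutes_orbit_subset[OF \<sigma>_permutes c])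
  then have fin: "finite ?C" by (rule finite_subset) simp
  have no_opp: "- k \<notin> ?C" if "k \<in> ?C" for k
  proof
    assume "- k \<in> ?C"
    then have "- k \<in> orbit \<sigma> k" using orbit_\<sigma>_eq[OF that] by simp
    then show False
      unfolding orbit_altdef_permutation[OF permutation_\<sigma>]
      using funpow_\<sigma>_neq_uminus[of k] that sub by fastforce
  qed
  have "particular (uminus ` ?C) \<longleftrightarrow> \<not> particular ?C"
  proof
    assume "particular (uminus ` ?C)"
    then obtain k where k: "- k \<in> ?C" "k > 0" "\<And>x. x \<in> ?C \<Longrightarrow> \<bar>k\<bar> \<le> \<bar>x\<bar>"
      unfolding particular_def by force
    show "\<not> particular ?C"
    proof
      assume "particular ?C"
      then obtain l where l: "l \<in> ?C" "l > 0" "\<And>x. x \<in> ?C \<Longrightarrow> \<bar>l\<bar> \<le> \<bar>x\<bar>"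
        unfolding particular_def by blast
      have "l = k" using k l(2) l(3)[OF k(1)] k(3)[OF l(1)] by simp
      with k l no_opp show False by blast
    qed
  next
    assume np: "\<not> particular ?C"
    obtain k where k: "k \<in> ?C" "\<And>x. x \<in> ?C \<Longrightarrow> \<bar>k\<bar> \<le> \<bar>x\<bar>"
      using ex_min_if_finite[of "abs ` ?C"] fin cC by (auto simp: not_less)
    have "k < 0" using np k sub unfolding particular_def pm_set_def by force
    then show "particular (uminus ` ?C)"
      using k unfolding particular_def by (intro bexI[of _ "- k"]) auto
  qed
  then show ?thesis
    using c unfolding half_def half_dom_def by (simp add: orbit_\<sigma>_uminus)
qed

lemma half_perm_permutes: "half_perm m \<sigma> permutes half"
proof (rule bij_imp_permutes)
  have "bij_betw \<sigma> half half"
    by (rule bij_betw_byWitness[where f' = "\<lambda>c. - \<sigma> (- c)"])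
       (use half_subset in \<open>auto simp: \<sigma>_in_half \<sigma>_in \<sigma>_reflect uminus_in_half subset_iff\<close>)
  then show "bij_betw (half_perm m \<sigma>) half half"
    by (rule bij_betw_cong[THEN iffD1, rotated]) (simp add: half_perm_def perm_restrict_def half_def)
qed (simp add: half_perm_def perm_restrict_def half_def)

lemma half_perm_eq: "c \<in> half \<Longrightarrow> half_perm m \<sigma> c = \<sigma> c"
  by (simp add: half_perm_def perm_restrict_def half_def)

text \<open>
  A negative label transposes the matrix but also exchanges \<open>\<eta> c\<close> and \<open>\<eta> (-c)\<close>, so it selects the same
  entry of \<open>D\<^sub>j\<close> as the positive label.
\<close>

lemma prod_half:
  fixes D :: "nat \<Rightarrow> real mat"
  assumes D: "\<And>j. j \<in> {1..m} \<Longrightarrow> D j \<in> carrier_mat (d (int j)) (d (int j))"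
    and d: "\<And>c. d (- c) = d c"
    and \<eta>: "\<And>c. c \<in> pm_set m \<Longrightarrow> \<eta> c < d c"
  shows "(\<Prod>c\<in>half. signed_mat D c $$ (\<eta> c, \<eta> (- c))) = (\<Prod>j\<in>{1..m}. D j $$ (\<eta> (int j), \<eta> (- int j)))"
proof (rule prod.reindex_bij_witness[where j = "\<lambda>c. nat \<bar>c\<bar>" and i = "\<lambda>j. if int j \<in> half then int j else - int j"])
  fix c assume c: "c \<in> half"
  then have cp: "c \<in> pm_set m" using half_subset by auto
  show "(if int (nat \<bar>c\<bar>) \<in> half then int (nat \<bar>c\<bar>) else - int (nat \<bar>c\<bar>)) = c"
    using c uminus_in_half[OF cp] by (cases "c > 0") auto
  show "nat \<bar>c\<bar> \<in> {1..m}" using cp by (auto simp: pm_set_def)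
  then have "D (nat \<bar>c\<bar>) \<in> carrier_mat (d c) (d c)"
    using D[of "nat \<bar>c\<bar>"] d[of c] by (cases "c > 0") auto
  then show "D (nat \<bar>c\<bar>) $$ (\<eta> (int (nat \<bar>c\<bar>)), \<eta> (- int (nat \<bar>c\<bar>))) = signed_mat D c $$ (\<eta> c, \<eta> (- c))"
    using \<eta>[OF cp] \<eta>[of "- c"] cp d[of c]
    by (cases "c > 0") (auto simp: signed_mat_def)
next
  fix j assume "j \<in> {1..m}"
  then have "int j \<in> pm_set m" by (auto simp: pm_set_def)
  then show "(if int j \<in> half then int j else - int j) \<in> half"
    using uminus_in_half by auto
qed auto

text \<open>
  A function on the labels of the particular cycles extends uniquely to a compatible function on all
  labels: the label \<open>-c\<close> receives the index of \<open>\<sigma> c\<close>. Conversely compatibility makes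
  \<open>\<eta> (-c)\<close> the column index needed for the trace along the cycle of \<open>c\<close>.
\<close>

theorem Tr_perm_half:
  fixes D :: "nat \<Rightarrow> real mat"
  assumes D: "\<And>j. j \<in> {1..m} \<Longrightarrow> D j \<in> carrier_mat (d (int j)) (d (int j))"
    and d: "\<And>x y. even x = even y \<Longrightarrow> d x = d y"
  shows "Tr_perm (half_dom m \<sigma>) (half_perm m \<sigma>) D =
    (\<Sum>\<eta>\<in>PiE (pm_set m) (\<lambda>c. {..<d c}).
      (\<Prod>j\<in>{1..m}. D j $$ (\<eta> (int j), \<eta> (- int j))) * of_bool (\<forall>c\<in>pm_set m. \<eta> (- c) = \<eta> (\<sigma> c)))"
proof -
  let ?T = "\<lambda>c. {..<d c}"
  have d\<sigma>: "d (\<sigma> c) = d c" if "c \<in> pm_set m" for c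
    by (rule d) (simp add: \<sigma>_parity that)
  have d_uminus: "d (- c) = d c" for c by (rule d) simp
  have fin: "finite half" using half_subset by (rule finite_subset) simp
  have carr: "signed_mat D c \<in> carrier_mat (d c) (d (half_perm m \<sigma> c))" if c: "c \<in> half" for c
  proof -
    have cp: "c \<in> pm_set m" using c half_subset by auto
    then have "nat \<bar>c\<bar> \<in> {1..m}" by (auto simp: pm_set_def)
    then have "D (nat \<bar>c\<bar>) \<in> carrier_mat (d c) (d c)"
      using D[of "nat \<bar>c\<bar>"] d_uminus[of c] by (cases "c > 0") auto
    then show ?thesis
      using c cp by (auto simp: half_perm_eq d\<sigma> signed_mat_def pm_set_def split: if_splits)
  qed
  let ?E = "{\<eta> \<in> PiE (pm_set m) ?T. \<forall>c\<in>pm_set m. \<eta> (- c) = \<eta> (\<sigma> c)}"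
  have "Tr_perm (half_dom m \<sigma>) (half_perm m \<sigma>) D =
      (\<Sum>\<iota>\<in>PiE half ?T. \<Prod>c\<in>half. signed_mat D c $$ (\<iota> c, \<iota> (half_perm m \<sigma> c)))"
    unfolding half_def[symmetric] by (rule Tr_perm_eq_sum[OF half_perm_permutes fin carr])
  also have "\<dots> = (\<Sum>\<iota>\<in>PiE half ?T. \<Prod>c\<in>half. signed_mat D c $$ (\<iota> c, \<iota> (\<sigma> c)))"
    by (intro sum.cong prod.cong refl) (simp add: half_perm_eq)
  also have "\<dots> = (\<Sum>\<eta>\<in>?E. \<Prod>j\<in>{1..m}. D j $$ (\<eta> (int j), \<eta> (- int j)))"
  proof (rule sum.reindex_bij_witness[symmetric, where j = "\<lambda>\<eta>. restrict \<eta> half"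
        and i = "\<lambda>\<iota>. \<lambda>c\<in>pm_set m. if c \<in> half then \<iota> c else \<iota> (\<sigma> (- c))"])
    fix \<eta> assume \<eta>: "\<eta> \<in> ?E"
    have "(if c \<in> half then restrict \<eta> half c else restrict \<eta> half (\<sigma> (- c))) = \<eta> c" if c: "c \<in> pm_set m" for c
    proof (cases "c \<in> half")
      case False
      then have "- c \<in> half" using uminus_in_half[OF c] by simp
      then have "\<sigma> (- c) \<in> half" using \<sigma>_in_half[of "- c"] c by simp
      then show ?thesis using \<eta> c False by (auto dest: bspec[of _ _ "- c"])
    qed simp
    then show "(\<lambda>c\<in>pm_set m. if c \<in> half then restrict \<eta> half c else restrict \<eta> half (\<sigma> (- c))) = \<eta>"
      using \<eta> by (intro extensionalityI[of _ "pm_set m"]) (auto simp: PiE_iff)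
    show "restrict \<eta> half \<in> PiE half ?T" using \<eta> half_subset by auto
    have "(\<Prod>c\<in>half. signed_mat D c $$ (restrict \<eta> half c, restrict \<eta> half (\<sigma> c))) =
        (\<Prod>c\<in>half. signed_mat D c $$ (\<eta> c, \<eta> (- c)))"
      using \<eta> half_subset by (intro prod.cong refl) (auto simp: \<sigma>_in_half)
    also have "\<dots> = (\<Prod>j\<in>{1..m}. D j $$ (\<eta> (int j), \<eta> (- int j)))"
      using \<eta> by (intro prod_half[of D d] D d_uminus) auto
    finally show "(\<Prod>c\<in>half. signed_mat D c $$ (restrict \<eta> half c, restrict \<eta> half (\<sigma> c))) =
        (\<Prod>j\<in>{1..m}. D j $$ (\<eta> (int j), \<eta> (- int j)))" .
  next
    fix \<iota> assume \<iota>: "\<iota> \<in> PiE half ?T"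
    define \<eta> where "\<eta> = (\<lambda>c\<in>pm_set m. if c \<in> half then \<iota> c else \<iota> (\<sigma> (- c)))"
    show "restrict \<eta> half = \<iota>"
      using \<iota> half_subset by (intro extensionalityI[of _ half]) (auto simp: PiE_iff \<eta>_def)
    have "\<eta> c < d c" if c: "c \<in> pm_set m" for c
    proof (cases "c \<in> half")
      case True then show ?thesis using c \<iota> by (auto simp: \<eta>_def)
    next
      case False
      then have "- c \<in> half" using uminus_in_half[OF c] by simp
      then have "\<sigma> (- c) \<in> half" using \<sigma>_in_half[of "- c"] c by simp
      then have "\<iota> (\<sigma> (- c)) < d (\<sigma> (- c))" using \<iota> by auto
      then show ?thesis using False c d\<sigma>[of "- c"] by (simp add: \<eta>_def d_uminus)
    qed
    moreover have "\<eta> (- c) = \<eta> (\<sigma> c)" if c: "c \<in> pm_set m" for c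
      using c uminus_in_half[OF c] \<sigma>_in_half[OF c] \<sigma>_in[OF c] \<sigma>_reflect[OF c] by (auto simp: \<eta>_def)
    ultimately show "\<eta> \<in> ?E" by (auto simp: \<eta>_def)
  qed
  also have "\<dots> = (\<Sum>\<eta>\<in>PiE (pm_set m) ?T.
      (\<Prod>j\<in>{1..m}. D j $$ (\<eta> (int j), \<eta> (- int j))) * of_bool (\<forall>c\<in>pm_set m. \<eta> (- c) = \<eta> (\<sigma> c)))"
    by (rule sum.mono_neutral_cong_left) (auto intro: finite_PiE)
  finally show ?thesis .
qed

end

lemma pi_hat_pos:
  assumes "\<pi> \<in> pairings m" "k \<in> {1..int m}"
  shows "pi_hat m \<pi> k =
    (if even k = even (pairing_perm \<pi> k) then - pairing_perm \<pi> k else pairing_perm \<pi> k)"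
proof -
  have l: "pairing_perm \<pi> k \<in> {1..int m}" by (rule pairing_perm_props[OF assms])
  have fixed: "pairing_perm \<pi> (- j) = - j" if "j \<in> {1..int m}" for j
    using that by (intro pairing_perm_outside[OF assms(1)]) auto
  show ?thesis
    using assms(2) l fixed[OF assms(2)] fixed[OF l]
    by (simp add: pi_hat_def delta_def delta'_def)
qed

lemma pi_hat_neg:
  assumes "\<pi> \<in> pairings m" "k \<in> {1..int m}"
  shows "pi_hat m \<pi> (- k) =
    (if even k = even (pairing_perm \<pi> k) then pairing_perm \<pi> k else - pairing_perm \<pi> k)"
proof -
  have l: "pairing_perm \<pi> k \<in> {1..int m}" by (rule pairing_perm_props[OF assms])
  have fixed: "pairing_perm \<pi> (- j) = - j" if "j \<in> {1..int m}" for j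
    using that by (intro pairing_perm_outside[OF assms(1)]) auto
  show ?thesis
    using assms(2) l fixed[OF assms(2)] fixed[OF l]
    by (simp add: pi_hat_def delta_def delta'_def)
qed

lemma pi_hat_outside:
  assumes "\<pi> \<in> pairings m" "k \<notin> pm_set m"
  shows "pi_hat m \<pi> k = k"
proof -
  have "pairing_perm \<pi> k = k"
    using assms by (intro pairing_perm_outside[OF assms(1)]) (auto simp: pm_set_def)
  then show ?thesis
    using assms(2) by (auto simp: pi_hat_def delta_def delta'_def pm_set_def)
qed

lemma pairing_premap_gamma:
  assumes \<pi>: "\<pi> \<in> pairings m" and m: "m = 2 * partial_sum ns r"
    and ns: "\<And>k. k \<in> {1..r} \<Longrightarrow> ns k > 0"
  shows "pairing_premap m (gamma_plus ns r) (pairing_perm \<pi>)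
    (perm_inv (gamma_minus ns r) \<circ> pi_hat m \<pi> \<circ> gamma_plus ns r)"
proof -
  let ?\<gamma> = "gamma_plus ns r"
  have perm: "?\<gamma> permutes {1..int m}" using gamma_plus_permutes[of ns r] m by simp
  have inv_pos: "perm_inv (gamma_minus ns r) l = l" if "l \<ge> 0" for l
    using that permutes_not_in[OF permutes_inv[OF perm], of "- l"]
    by (simp add: inv_gamma_minus)
  have inv_neg: "perm_inv (gamma_minus ns r) (- l) = - perm_inv ?\<gamma> l" for l
    by (simp add: inv_gamma_minus)
  note p = pairing_perm_props[OF \<pi>]
  show ?thesis
  proof
    show "?\<gamma> permutes {1..int m}" by fact
    show "even (?\<gamma> k) \<longleftrightarrow> odd k" if "k \<in> {1..int m}" for k
      using gamma_plus_parity[where ns = ns and r = r and x = k, OF ns] that m by simp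
    show "pairing_perm \<pi> k \<in> {1..int m}" "pairing_perm \<pi> (pairing_perm \<pi> k) = k"
      "pairing_perm \<pi> k \<noteq> k" if "k \<in> {1..int m}" for k
      using p[OF that] by auto
    show "(perm_inv (gamma_minus ns r) \<circ> pi_hat m \<pi> \<circ> ?\<gamma>) k =
        (if even (?\<gamma> k) = even (pairing_perm \<pi> (?\<gamma> k)) then - perm_inv ?\<gamma> (pairing_perm \<pi> (?\<gamma> k))
         else pairing_perm \<pi> (?\<gamma> k))" if k: "k \<in> {1..int m}" for k
    proof -
      have q: "?\<gamma> k \<in> {1..int m}" using permutes_in_image[OF perm] k by blast
      show ?thesis using p(1)[OF q] by (simp add: pi_hat_pos[OF \<pi> q] inv_neg inv_pos)
    qed
    show "(perm_inv (gamma_minus ns r) \<circ> pi_hat m \<pi> \<circ> ?\<gamma>) (- k) =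
        (if even k = even (pairing_perm \<pi> k) then pairing_perm \<pi> k
         else - perm_inv ?\<gamma> (pairing_perm \<pi> k))" if k: "k \<in> {1..int m}" for k
    proof -
      have "?\<gamma> (- k) = - k" using k by (intro permutes_not_in[OF perm]) auto
      then show ?thesis using p(1)[OF k] by (simp add: pi_hat_neg[OF \<pi> k] inv_neg inv_pos)
    qed
    show "(perm_inv (gamma_minus ns r) \<circ> pi_hat m \<pi> \<circ> ?\<gamma>) k = k" if k: "k \<notin> pm_set m" for k
    proof -
      have "?\<gamma> k = k" using k by (intro permutes_not_in[OF perm]) (auto simp: pm_set_def)
      moreover have "perm_inv (gamma_minus ns r) k = k"
      proof -
        have "- k \<notin> {1..int m}" using k by (auto simp: pm_set_def)
        then show ?thesis
          using permutes_not_in[OF permutes_inv[OF perm]] by (simp add: inv_gamma_minus)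
      qed
      ultimately show ?thesis using pi_hat_outside[OF \<pi> k] by simp
    qed
  qed
qed

section \<open>Index functions and the expansion of \<open>Y\<^sub>1 \<cdots> Y\<^sub>r\<close>\<close>

text \<open>
  The position in \<open>X\<^bsub>g\<^sub>k\<^esub>\<close> of the entry that \<open>\<eta>\<close> selects from the random factor at position \<open>k\<close>. That
  factor has indices \<open>\<eta> (- \<gamma>\<^sup>-\<^sup>1 k)\<close> and \<open>\<eta> k\<close>; for odd \<open>k\<close> it is the transpose of \<open>X\<^bsub>g\<^sub>k\<^esub>\<close>, which swaps
  them.
\<close>

definition row_index :: "(int \<Rightarrow> int) \<Rightarrow> (int \<Rightarrow> nat) \<Rightarrow> int \<Rightarrow> nat" where
  "row_index \<gamma> \<eta> k = (if odd k then \<eta> k else \<eta> (- perm_inv \<gamma> k))"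

definition col_index :: "(int \<Rightarrow> int) \<Rightarrow> (int \<Rightarrow> nat) \<Rightarrow> int \<Rightarrow> nat" where
  "col_index \<gamma> \<eta> k = (if odd k then \<eta> (- perm_inv \<gamma> k) else \<eta> k)"

text \<open>
  This is where the definition of \<open>\<sigma>\<close> pays off: the equation at \<open>c = -k\<close> concerns the index that
  \<open>k\<close> shares with \<open>D\<^sub>k\<close>, the equation at \<open>c = \<gamma>\<^sup>-\<^sup>1 k\<close> the index that it shares with the preceding
  \<open>D\<close>.
\<close>

lemma (in pairing_premap) compatible_iff:
  "(\<forall>c\<in>pm_set m. \<eta> (- c) = \<eta> (\<sigma> c)) \<longleftrightarrow>
   (\<forall>k\<in>{1..int m}. row_index \<gamma> \<eta> k = row_index \<gamma> \<eta> (p k) \<and> col_index \<gamma> \<eta> k = col_index \<gamma> \<eta> (p k))"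
  (is "?L \<longleftrightarrow> ?R")
proof
  assume L: ?L
  show ?R
  proof
    fix k assume k: "k \<in> {1..int m}"
    have "\<eta> k = \<eta> (\<sigma> (- k))" using L pm_setI(2)[OF k] by fastforce
    moreover have "\<eta> (- perm_inv \<gamma> k) = \<eta> (\<sigma> (perm_inv \<gamma> k))"
      using L pm_setI(1)[OF inv_\<gamma>_in[OF k]] by blast
    ultimately show "row_index \<gamma> \<eta> k = row_index \<gamma> \<eta> (p k) \<and> col_index \<gamma> \<eta> k = col_index \<gamma> \<eta> (p k)"
      unfolding \<sigma>_neg[OF k] \<sigma>_pos[OF inv_\<gamma>_in[OF k]] \<gamma>_inverses row_index_def col_index_def
      by (auto split: if_splits)
  qed
next
  assume R: ?R
  show ?L
  proof
    fix c assume "c \<in> pm_set m"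
    then show "\<eta> (- c) = \<eta> (\<sigma> c)"
    proof (cases rule: pm_cases)
      case 1
      then show ?thesis using bspec[OF R \<gamma>_in[OF 1]]
        unfolding \<sigma>_pos[OF 1] row_index_def col_index_def \<gamma>_inverses by (auto split: if_splits)
    next
      case (2 k)
      then show ?thesis using bspec[OF R 2(2)]
        unfolding 2(1) \<sigma>_neg[OF 2(2)] row_index_def col_index_def \<gamma>_inverses by (auto split: if_splits)
    qed
  qed
qed

lemma pairing_perm_Min:
  assumes "\<pi> \<in> pairings m" "B \<in> \<pi>"
  shows "Min B \<in> {1..m}" "Max B \<in> {1..m}" "pairing_perm \<pi> (int (Min B)) = int (Max B)"
proof -
  have P: "partition_on {1..m} \<pi>" and two: "card B = 2" using assms by (auto simp: pairings_def)
  have B: "B = {Min B, Max B}" "Min B < Max B" using card_2_Min_Max[OF two] by auto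
  have "B \<subseteq> {1..m}" using P assms by (auto simp: partition_on_def)
  then show mem: "Min B \<in> {1..m}" "Max B \<in> {1..m}" using B by blast+
  let ?k = "int (Min B)"
  have k: "?k \<in> {1..int m}" using mem by auto
  have "{nat ?k, nat (pairing_perm \<pi> ?k)} \<in> \<pi>" by (rule pairing_perm_props[OF assms(1) k])
  moreover have "disjoint \<pi>" using P by (simp add: partition_on_def)
  moreover have "Min B \<in> B" using B by blast
  ultimately have "{nat ?k, nat (pairing_perm \<pi> ?k)} = B"
    using assms(2) disjointD[of \<pi> "{nat ?k, nat (pairing_perm \<pi> ?k)}" B] by auto
  then have "{Min B, nat (pairing_perm \<pi> ?k)} = {Min B, Max B}" using B by simp
  then have "nat (pairing_perm \<pi> ?k) = Max B" by (auto simp: doubleton_eq_iff)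
  then show "pairing_perm \<pi> ?k = int (Max B)"
    using pairing_perm_props(1)[OF assms(1) k] by auto
qed

lemma ball_pairing_iff:
  assumes \<pi>: "\<pi> \<in> pairings m"
  shows "(\<forall>k\<in>{1..int m}. h k = h (pairing_perm \<pi> k)) \<longleftrightarrow>
         (\<forall>B\<in>\<pi>. h (int (Min B)) = h (int (Max B)))"
proof
  assume L: "\<forall>k\<in>{1..int m}. h k = h (pairing_perm \<pi> k)"
  show "\<forall>B\<in>\<pi>. h (int (Min B)) = h (int (Max B))"
  proof
    fix B assume "B \<in> \<pi>"
    note B = pairing_perm_Min[OF \<pi> this]
    show "h (int (Min B)) = h (int (Max B))" using bspec[OF L, of "int (Min B)"] B by auto
  qed
next
  assume R: "\<forall>B\<in>\<pi>. h (int (Min B)) = h (int (Max B))"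
  show "\<forall>k\<in>{1..int m}. h k = h (pairing_perm \<pi> k)"
  proof
    fix k assume k: "k \<in> {1..int m}"
    let ?B = "{nat k, nat (pairing_perm \<pi> k)}"
    have "h (int (Min ?B)) = h (int (Max ?B))"
      using R pairing_perm_props(4)[OF \<pi> k] by blast
    then show "h k = h (pairing_perm \<pi> k)"
      using k pairing_perm_props(1)[OF \<pi> k] by (auto simp: min_def max_def split: if_splits)
  qed
qed

text \<open>
  For the product of factors \<open>X\<close>, \<open>D\<close> in alternation: each element of a cycle is replaced by two labels.
\<close>

lemma cycle_list_interleave:
  assumes xs: "cycle_list \<gamma> xs"
    and u: "inj_on u (set xs)" and v: "inj_on v (set xs)"
    and uv: "u ` set xs \<inter> v ` set xs = {}"
    and \<tau>: "\<And>x. x \<in> set xs \<Longrightarrow> \<tau> (u x) = v x" "\<And>x. x \<in> set xs \<Longrightarrow> \<tau> (v x) = u (\<gamma> x)"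
  shows "cycle_list \<tau> (concat (map (\<lambda>x. [u x, v x]) xs))"
proof -
  let ?L = "\<lambda>xs. concat (map (\<lambda>x. [u x, v x]) xs)"
  have c: "xs \<noteq> []" "distinct xs" "successively (\<lambda>x y. y = \<gamma> x) xs" "\<gamma> (last xs) = hd xs"
    using xs by (auto simp: cycle_list_def)
  have dist: "distinct (?L ys)" if "distinct ys" "set ys \<subseteq> set xs" for ys
    using that
  proof (induction ys)
    case (Cons y ys)
    have "u y \<notin> u ` set ys" "v y \<notin> v ` set ys"
      using Cons.prems inj_on_image_mem_iff[OF u, of y "set ys"]
        inj_on_image_mem_iff[OF v, of y "set ys"] by auto
    moreover have "u y \<notin> v ` set ys" "v y \<notin> u ` set ys" "u y \<noteq> v y"
      using Cons.prems uv by auto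
    ultimately show ?case using Cons by auto
  qed simp
  have succ: "successively (\<lambda>x y. y = \<tau> x) (?L ys)"
    if "successively (\<lambda>x y. y = \<gamma> x) ys" "set ys \<subseteq> set xs" for ys
    using that
  proof (induction ys rule: induct_list012)
    case (3 y z ys)
    have z: "z = \<gamma> y" and zys: "successively (\<lambda>x y. y = \<gamma> x) (z # ys)"
      using successively.simps(3)[THEN iffD1, OF "3.prems"(1)] by blast+
    have "successively (\<lambda>x y. y = \<tau> x) (?L (z # ys))"
      by (rule "3.IH"(2)[OF zys]) (use "3.prems"(2) in simp)
    moreover have "?L (z # ys) = u z # v z # ?L ys" by simp
    ultimately have "successively (\<lambda>x y. y = \<tau> x) (u z # v z # ?L ys)"
      by (simp only:)
    moreover have "v y = \<tau> (u y)" "u z = \<tau> (v y)" using \<tau>[of y] z "3.prems"(2) by simp_all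
    ultimately have "successively (\<lambda>x y. y = \<tau> x) (u y # v y # u z # v z # ?L ys)"
      unfolding successively.simps(3)[of _ "u y"] successively.simps(3)[of _ "v y"] by blast
    moreover have "?L (y # z # ys) = u y # v y # u z # v z # ?L ys" by simp
    ultimately show ?case by (simp only:)
  qed (auto simp: \<tau>)
  have "hd (?L xs) = u (hd xs)" "?L xs \<noteq> []" using c(1) by (cases xs; simp)+
  moreover have "last (?L xs) = v (last xs)"
    using c(1) by (cases xs rule: rev_cases) auto
  ultimately show ?thesis
    using dist[OF c(2) subset_refl] succ[OF c(3) subset_refl] c \<tau>(2)[of "last xs"]
    unfolding cycle_list_def by simp
qed

lemma block_list_eq_map_int:
  "block_list ns k = map int [2 * partial_sum ns (k - 1) + 1 ..< 2 * partial_sum ns k + 1]"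
  unfolding block_list_def by (rule nth_equalityI) (auto simp: nth_upto simp del: upt_Suc)

text \<open>
  The number of rows and of columns of \<open>D\<^sub>j\<close>, as a function of the signed label, since \<open>D\<^sub>j\<close> has as many
  rows as columns.
\<close>

definition index_dim :: "nat \<Rightarrow> nat \<Rightarrow> int \<Rightarrow> nat" where
  "index_dim M N c = (if odd c then M else N)"

text \<open>
  The factor \<open>D\<^sub>j\<close> gets the label \<open>j\<close> and the random factor at position \<open>j\<close> the label
  \<open>- \<gamma>\<^sup>-\<^sup>1 j\<close>. With these labels \<open>\<eta> j\<close> and \<open>\<eta> (-j)\<close> are the two indices of \<open>D\<^sub>j\<close>, and the factors
  of all \<open>Y\<^sub>k\<close> together use each label of \<open>[\<plusminus>2n]\<close> exactly once.
\<close>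

lemma prod_Y_expansion:
  fixes X :: "'h \<Rightarrow> 'w \<Rightarrow> real mat" and D :: "nat \<Rightarrow> real mat"
    and ns :: "nat \<Rightarrow> nat" and r :: nat
  defines "\<gamma> \<equiv> gamma_plus ns r"
  assumes m: "m = 2 * partial_sum ns r"
    and ns: "\<And>k. k \<in> {1..r} \<Longrightarrow> ns k > 0"
    and X: "\<And>h. X h \<omega> \<in> carrier_mat M N"
    and D: "\<And>j. j \<in> {1..m} \<Longrightarrow> D j \<in> carrier_mat (index_dim M N (int j)) (index_dim M N (int j))"
  shows "(\<Prod>k = 1..r. Y N ns X g D k \<omega>) = (1 / real N) ^ r *
    (\<Sum>\<eta>\<in>PiE (pm_set m) (\<lambda>c. {..<index_dim M N c}).
      (\<Prod>j\<in>{1..m}. D j $$ (\<eta> (int j), \<eta> (- int j))) *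
      (\<Prod>j\<in>{1..m}. X (g j) \<omega> $$ (row_index \<gamma> \<eta> (int j), col_index \<gamma> \<eta> (int j))))"
proof -
  let ?d = "index_dim M N" and ?T = "\<lambda>c. {..<index_dim M N c}"
  have perm: "\<gamma> permutes {1..int m}" using gamma_plus_permutes[of ns r] m by (simp add: \<gamma>_def)
  have \<gamma>_in: "\<gamma> c \<in> {1..int m}" if "c \<in> {1..int m}" for c
    using permutes_in_image[OF perm] that by blast
  have inv_in: "perm_inv \<gamma> c \<in> {1..int m}" if "c \<in> {1..int m}" for c
    using permutes_in_image[OF permutes_inv[OF perm]] that by blast
  note inv = permutes_inverses[OF perm]
  have parity: "even (\<gamma> c) \<longleftrightarrow> odd c" if "c \<in> {1..int m}" for c
    using gamma_plus_parity[where ns = ns and r = r and x = c, OF ns] that m by (simp add: \<gamma>_def)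
  \<comment> \<open>\<open>B c\<close> is the factor with label \<open>c\<close>, \<open>\<tau> c\<close> the label of the factor that follows it, and
    \<open>L k\<close> lists the labels of the factors of \<open>Y\<^sub>k\<close>.\<close>
  define W where "W j = (if odd j then transpose_mat (X (g j) \<omega>) else X (g j) \<omega>)" for j
  define B where "B c = (if c > 0 then D (nat c) else W (nat (\<gamma> (- c))))" for c
  define \<tau> where "\<tau> c = (if c > 0 then - c else \<gamma> (- c))" for c
  define L where "L k = concat (map (\<lambda>j. [- perm_inv \<gamma> j, j]) (block_list ns k))" for k
  have block: "x \<in> {1..int m}" if "x \<in> set (block_list ns k)" "k \<in> {1..r}" for x k
    using block_list_subset[of k r ns] that m by auto
  have set_L: "set (L k) = (\<lambda>j. - perm_inv \<gamma> j) ` set (block_list ns k) \<union> set (block_list ns k)" for k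
    by (auto simp: L_def)
  have cyc: "cycle_list \<tau> (L k)" if k: "k \<in> {1..r}" for k
    unfolding L_def
  proof (rule cycle_list_interleave)
    show "cycle_list \<gamma> (block_list ns k)" unfolding \<gamma>_def by (rule cycle_list_gamma_plus[OF k ns])
    show "inj_on (\<lambda>j. - perm_inv \<gamma> j) (set (block_list ns k))"
      by (rule inj_onI) (metis inv(1) minus_equation_iff)
    have neg: "- perm_inv \<gamma> x < 0" if "x \<in> set (block_list ns k)" for x
      using inv_in[OF block[OF that k]] by auto
    then show "(\<lambda>j. - perm_inv \<gamma> j) ` set (block_list ns k) \<inter> (\<lambda>j. j) ` set (block_list ns k) = {}"
      using block[OF _ k] by fastforce
    fix x assume x: "x \<in> set (block_list ns k)"
    show "\<tau> (- perm_inv \<gamma> x) = x" using neg[OF x] by (simp add: \<tau>_def inv)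
    show "\<tau> x = - perm_inv \<gamma> (\<gamma> x)" using block[OF x k] by (simp add: \<tau>_def inv)
  qed simp
  have Yk: "Y N ns X g D k \<omega> = 1 / real N * mat_trace (mat_list_prod (map B (L k)))" if k: "k \<in> {1..r}" for k
  proof -
    have "map B (L k) = concat (map (\<lambda>j. [B (- perm_inv \<gamma> j), B j]) (block_list ns k))"
      by (simp add: L_def map_concat comp_def)
    also have "\<dots> = concat (map (\<lambda>j. [W (nat j), D (nat j)]) (block_list ns k))"
    proof (intro arg_cong[of _ _ concat] map_cong refl)
      fix j assume "j \<in> set (block_list ns k)"
      then have j: "j \<in> {1..int m}" using block k by blast
      then show "[B (- perm_inv \<gamma> j), B j] = [W (nat j), D (nat j)]"
        using inv_in[OF j] by (simp add: B_def inv)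
    qed
    also have "\<dots> = concat (map (\<lambda>j. [W j, D j])
        [2 * partial_sum ns (k - 1) + 1 ..< 2 * partial_sum ns k + 1])"
      by (simp add: block_list_eq_map_int comp_def del: upt_Suc)
    finally show ?thesis unfolding Y_def W_def by simp
  qed
  have disj: "set (L k) \<inter> set (L l) = {}" if kl: "k \<in> {1..r}" "l \<in> {1..r}" "k \<noteq> l" for k l
  proof -
    have bl: "set (block_list ns k) \<inter> set (block_list ns l) = {}"
      using block_list_disjoint[of k l ns] block_list_disjoint[of l k ns] kl(3)
      by (cases k l rule: linorder_cases) auto
    have "inj (\<lambda>j. - perm_inv \<gamma> j)"
      by (rule injI) (metis inv(1) neg_equal_iff_equal)
    then have "(\<lambda>j. - perm_inv \<gamma> j) ` set (block_list ns k) \<inter> (\<lambda>j. - perm_inv \<gamma> j) ` set (block_list ns l) = {}"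
      using bl by (metis image_Int image_empty)
    moreover have neg: "(\<lambda>j. - perm_inv \<gamma> j) ` A \<inter> A' = {}" if "A \<subseteq> {1..int m}" "A' \<subseteq> {1..int m}" for A A'
      using inv_in that by force
    have "set (block_list ns k) \<subseteq> {1..int m}" "set (block_list ns l) \<subseteq> {1..int m}"
      using block kl by blast+
    note neg[OF this] neg[OF this(2,1)]
    ultimately show ?thesis using bl unfolding set_L by blast
  qed
  have pm: "pm_set m = {1..int m} \<union> uminus ` {1..int m}"
  proof -
    have "c \<in> uminus ` {1..int m}" if "c < 0" "- c \<le> int m" for c
      using that by (intro image_eqI[of _ _ "- c"]) auto
    then show ?thesis by (auto simp: pm_set_def)
  qed
  have UN: "pm_set m = (\<Union>k\<in>{1..r}. set (L k))"
  proof -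
    have blocks: "(\<Union>k\<in>{1..r}. set (block_list ns k)) = {1..int m}"
      unfolding UN_block_list m by simp
    have "perm_inv \<gamma> ` {1..int m} = {1..int m}"
      by (rule permutes_image[OF permutes_inv[OF perm]])
    then have "(\<lambda>j. - perm_inv \<gamma> j) ` {1..int m} = uminus ` {1..int m}"
      by (metis image_image)
    then show ?thesis
      unfolding pm set_L using blocks by (simp add: UN_Un_distrib image_UN[symmetric] Un_commute)
  qed
  have carr: "B c \<in> carrier_mat (?d c) (?d (\<tau> c))" if "c \<in> pm_set m" for c
  proof (cases "c > 0")
    case True
    then have "nat c \<in> {1..m}" using that by (auto simp: pm_set_def)
    then show ?thesis using D[of "nat c"] True by (simp add: B_def \<tau>_def index_dim_def)
  next
    case False
    then have c: "- c \<in> {1..int m}" using that by (auto simp: pm_set_def)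
    have "even (nat (\<gamma> (- c))) \<longleftrightarrow> odd c"
      using parity[OF c] \<gamma>_in[OF c] by (simp add: even_nat_iff)
    then show ?thesis
      using False X parity[OF c] by (simp add: B_def \<tau>_def W_def index_dim_def)
  qed
  have "(\<Prod>k = 1..r. Y N ns X g D k \<omega>) =
      (1 / real N) ^ r * (\<Prod>k\<in>{1..r}. mat_trace (mat_list_prod (map B (L k))))"
  proof -
    have "(\<Prod>k = 1..r. Y N ns X g D k \<omega>) =
        (\<Prod>k = 1..r. 1 / real N * mat_trace (mat_list_prod (map B (L k))))"
      by (intro prod.cong refl Yk)
    then show ?thesis by (simp only: prod.distrib prod_constant card_atLeastAtMost) simp
  qed
  also have "(\<Prod>k\<in>{1..r}. mat_trace (mat_list_prod (map B (L k)))) =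
      (\<Sum>\<eta>\<in>PiE (pm_set m) ?T. \<Prod>c\<in>pm_set m. B c $$ (\<eta> c, \<eta> (\<tau> c)))"
    by (rule prod_mat_trace_cycle_lists[where K = "{1..r}" and L = L and d = ?d, OF _ cyc disj UN carr]) auto
  also have "\<dots> = (\<Sum>\<eta>\<in>PiE (pm_set m) ?T.
      (\<Prod>j\<in>{1..m}. D j $$ (\<eta> (int j), \<eta> (- int j))) *
      (\<Prod>j\<in>{1..m}. X (g j) \<omega> $$ (row_index \<gamma> \<eta> (int j), col_index \<gamma> \<eta> (int j))))"
  proof (rule sum.cong[OF refl])
    fix \<eta> assume \<eta>: "\<eta> \<in> PiE (pm_set m) ?T"
    have "(\<Prod>c\<in>pm_set m. B c $$ (\<eta> c, \<eta> (\<tau> c))) =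
        (\<Prod>c\<in>{1..int m}. B c $$ (\<eta> c, \<eta> (\<tau> c))) * (\<Prod>c\<in>uminus ` {1..int m}. B c $$ (\<eta> c, \<eta> (\<tau> c)))"
      unfolding pm by (rule prod.union_disjoint) auto
    also have "(\<Prod>c\<in>{1..int m}. B c $$ (\<eta> c, \<eta> (\<tau> c))) = (\<Prod>j\<in>{1..m}. D j $$ (\<eta> (int j), \<eta> (- int j)))"
      by (rule prod.reindex_bij_witness[where i = int and j = nat]) (auto simp: B_def \<tau>_def)
    also have "(\<Prod>c\<in>uminus ` {1..int m}. B c $$ (\<eta> c, \<eta> (\<tau> c))) =
        (\<Prod>j\<in>{1..m}. X (g j) \<omega> $$ (row_index \<gamma> \<eta> (int j), col_index \<gamma> \<eta> (int j)))"
    proof (rule prod.reindex_bij_witness[where i = "\<lambda>j. - perm_inv \<gamma> (int j)" and j = "\<lambda>c. nat (\<gamma> (- c))"])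
      fix j assume "j \<in> {1..m}"
      then have j: "int j \<in> {1..int m}" by auto
      show "nat (\<gamma> (- (- perm_inv \<gamma> (int j)))) = j" by (simp add: inv)
      show "- perm_inv \<gamma> (int j) \<in> uminus ` {1..int m}" using inv_in[OF j] by blast
    next
      fix c assume "c \<in> uminus ` {1..int m}"
      then have c: "- c \<in> {1..int m}" by auto
      have q: "\<gamma> (- c) \<in> {1..int m}" by (rule \<gamma>_in[OF c])
      then have int_nat: "int (nat (\<gamma> (- c))) = \<gamma> (- c)" by simp
      show "- perm_inv \<gamma> (int (nat (\<gamma> (- c)))) = c" by (simp only: int_nat inv minus_minus)
      show "nat (\<gamma> (- c)) \<in> {1..m}" using q by auto
      let ?j = "nat (\<gamma> (- c))"
      have pmc: "c \<in> pm_set m" "\<gamma> (- c) \<in> pm_set m" using c q by (auto simp: pm_set_def)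
      have bounds: "\<eta> c < ?d c" "\<eta> (\<gamma> (- c)) < ?d (\<gamma> (- c))"
        using \<eta> pmc by auto
      have "odd ?j \<longleftrightarrow> odd (\<gamma> (- c))" using q by (simp add: even_nat_iff)
      then show "X (g ?j) \<omega> $$ (row_index \<gamma> \<eta> (int ?j), col_index \<gamma> \<eta> (int ?j)) = B c $$ (\<eta> c, \<eta> (\<tau> c))"
        using c q bounds X[of "g ?j"] parity[OF c] unfolding int_nat
        by (auto simp: B_def \<tau>_def W_def inv row_index_def col_index_def index_dim_def)
    qed
    finally show "(\<Prod>c\<in>pm_set m. B c $$ (\<eta> c, \<eta> (\<tau> c))) =
      (\<Prod>j\<in>{1..m}. D j $$ (\<eta> (int j), \<eta> (- int j))) *
      (\<Prod>j\<in>{1..m}. X (g j) \<omega> $$ (row_index \<gamma> \<eta> (int j), col_index \<gamma> \<eta> (int j)))" .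
  qed
  finally show ?thesis .
qed

text \<open>
  The family may contain a variable several times, as the \<open>g\<^sub>k\<close> need not be distinct; repetitions become
  coefficients of the linear combination.
\<close>

lemma jointly_gaussian_sum_family:
  assumes "jointly_gaussian P I Z" "finite T" "h ` T \<subseteq> I"
  shows "gaussian_rv P (\<lambda>\<omega>. \<Sum>j\<in>T. Z (h j) \<omega>)"
proof -
  have "(\<Sum>j\<in>T. Z (h j) \<omega>) = (\<Sum>i\<in>h ` T. real (card {j \<in> T. h j = i}) * Z i \<omega>)" for \<omega>
    unfolding sum.image_gen[OF assms(2), of "\<lambda>j. Z (h j) \<omega>" h]
    by (intro sum.cong refl) simp
  then show ?thesis
    using assms unfolding jointly_gaussian_def by simp
qed

section \<open>The expectation\<close>

lemma gaussian_rv_integrable: "prob_space P \<Longrightarrow> gaussian_rv P Z \<Longrightarrow> integrable P Z"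
  using gaussian_rv_integrable_power[of P Z 1] by simp

theorem mainTheorem4:
  fixes P :: "'w measure"
    and f :: "'h::{real_inner, complete_space} \<Rightarrow> nat \<Rightarrow> nat \<Rightarrow> 'w \<Rightarrow> real"
    and X :: "'h \<Rightarrow> 'w \<Rightarrow> real mat"
    and D :: "nat \<Rightarrow> real mat"
    and g :: "nat \<Rightarrow> 'h"
    and ns :: "nat \<Rightarrow> nat"
    and r n M N :: nat
  assumes "prob_space P"
    and "r > 0" and "M > 0" and "N > 0"
    and "\<And>k. k \<in> {1..r} \<Longrightarrow> ns k > 0"
    and "n = (\<Sum>k = 1..r. ns k)"
    and "\<And>h \<omega>. \<omega> \<in> space P \<Longrightarrow> X h \<omega> \<in> carrier_mat M N"
    and "\<And>h i j \<omega>. \<omega> \<in> space P \<Longrightarrow> i < M \<Longrightarrow> j < N \<Longrightarrow>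
           X h \<omega> $$ (i, j) = 1 / sqrt (real N) * f h i j \<omega>"
    and "jointly_gaussian P (UNIV \<times> {..<M} \<times> {..<N}) (\<lambda>(h, i, j). f h i j)"
    and "\<And>h i j. i < M \<Longrightarrow> j < N \<Longrightarrow> prob_space.expectation P (f h i j) = 0"
    and "\<And>h h' i j i' j'. i < M \<Longrightarrow> j < N \<Longrightarrow> i' < M \<Longrightarrow> j' < N \<Longrightarrow> (i, j) \<noteq> (i', j') \<Longrightarrow>
           prob_space.indep_var P borel (f h i j) borel (f h' i' j')"
    and "\<And>h h' i j. i < M \<Longrightarrow> j < N \<Longrightarrow>
           prob_space.expectation P (\<lambda>\<omega>. f h i j \<omega> * f h' i j \<omega>) = inner h h'"
    and "\<And>m. m \<in> {1..2 * n} \<Longrightarrow> odd m \<Longrightarrow> D m \<in> carrier_mat M M"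
    and "\<And>m. m \<in> {1..2 * n} \<Longrightarrow> even m \<Longrightarrow> D m \<in> carrier_mat N N"
  shows "integrable P (\<lambda>\<omega>. \<Prod>k = 1..r. Y N ns X g D k \<omega>) \<and>
    prob_space.expectation P (\<lambda>\<omega>. \<Prod>k = 1..r. Y N ns X g D k \<omega>) =
      real N powi (- int n - int r) *
      (\<Sum>\<pi> \<in> pairings (2 * n).
         (\<Prod>B \<in> \<pi>. inner (g (Min B)) (g (Max B))) *
         (let \<sigma> = inv_into UNIV (gamma_minus ns r) \<circ> pi_hat (2 * n) \<pi> \<circ> gamma_plus ns r
          in Tr_perm (half_dom (2 * n) \<sigma>) (half_perm (2 * n) \<sigma>) D))"
proof -
  interpret prob_space P by fact
  define \<gamma> where "\<gamma> = gamma_plus ns r"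
  define m where "m = 2 * n"
  let ?d = "index_dim M N" and ?T = "\<lambda>c. {..<index_dim M N c}"
  define \<sigma> where "\<sigma> \<pi> = perm_inv (gamma_minus ns r) \<circ> pi_hat m \<pi> \<circ> gamma_plus ns r" for \<pi>
  define row where "row \<eta> j = row_index \<gamma> \<eta> (int j)" for \<eta> and j :: nat
  define col where "col \<eta> j = col_index \<gamma> \<eta> (int j)" for \<eta> and j :: nat
  define \<Delta> where "\<Delta> \<eta> = (\<Prod>j\<in>{1..m}. D j $$ (\<eta> (int j), \<eta> (- int j)))" for \<eta>
  define compat where "compat \<pi> \<eta> \<longleftrightarrow> (\<forall>c\<in>pm_set m. \<eta> (- c) = \<eta> (\<sigma> \<pi> c))" for \<pi> and \<eta> :: "int \<Rightarrow> nat"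
  define w where "w \<pi> = (\<Prod>B\<in>\<pi>. inner (g (Min B)) (g (Max B)))" for \<pi> :: "nat set set"
  have m: "m = 2 * partial_sum ns r" using assms(6) by (simp add: m_def partial_sum_def)
  have D: "D j \<in> carrier_mat (?d (int j)) (?d (int j))" if "j \<in> {1..m}" for j
    using assms(13,14)[of j] that by (auto simp: index_dim_def m_def)
  have perm: "\<gamma> permutes {1..int m}" using gamma_plus_permutes[of ns r] m by (simp add: \<gamma>_def)
  have bounds: "row \<eta> j < M" "col \<eta> j < N"
    if \<eta>: "\<eta> \<in> PiE (pm_set m) ?T" and j: "j \<in> {1..m}" for \<eta> j
  proof -
    let ?i = "perm_inv \<gamma> (int j)"
    have i: "?i \<in> {1..int m}"
      using permutes_in_image[OF permutes_inv[OF perm], of "int j"] j by auto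
    have "\<gamma> ?i = int j" by (rule permutes_inverses[OF perm])
    then have parity: "odd ?i \<longleftrightarrow> even j"
      using gamma_plus_parity[where ns = ns and r = r and x = ?i, OF assms(5)] i m by (auto simp: \<gamma>_def)
    have "int j \<in> pm_set m" "- ?i \<in> pm_set m" using j i by (auto simp: pm_set_def)
    then have "\<eta> (int j) < ?d (int j)" "\<eta> (- ?i) < ?d (- ?i)"
      using PiE_mem[OF \<eta>] by blast+
    then show "row \<eta> j < M" "col \<eta> j < N"
      using parity by (auto simp: row_def col_def row_index_def col_index_def index_dim_def split: if_splits)
  qed
  have Y_eq: "(\<Prod>k = 1..r. Y N ns X g D k \<omega>) =
      (\<Sum>\<eta>\<in>PiE (pm_set m) ?T. real N powi (- int n - int r) * \<Delta> \<eta> *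
        (\<Prod>j\<in>{1..m}. f (g j) (row \<eta> j) (col \<eta> j) \<omega>))" if \<omega>: "\<omega> \<in> space P" for \<omega>
  proof -
    have scale: "(1 / real N) ^ r * (1 / sqrt (real N)) ^ m = real N powi (- int n - int r)"
    proof -
      have "(1 / sqrt (real N)) ^ m = (1 / real N) ^ n"
        by (simp add: m_def power_mult power_divide)
      then have "(1 / real N) ^ r * (1 / sqrt (real N)) ^ m = (1 / real N) ^ (n + r)"
        by (simp add: power_add)
      also have "\<dots> = real N powi (- int (n + r))"
        unfolding power_int_minus power_int_of_nat by (simp add: inverse_eq_divide power_one_over)
      also have "- int (n + r) = - int n - int r" by simp
      finally show ?thesis .
    qed
    have "(\<Prod>j\<in>{1..m}. X (g j) \<omega> $$ (row \<eta> j, col \<eta> j)) =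
        (1 / sqrt (real N)) ^ m * (\<Prod>j\<in>{1..m}. f (g j) (row \<eta> j) (col \<eta> j) \<omega>)"
      if \<eta>: "\<eta> \<in> PiE (pm_set m) ?T" for \<eta>
    proof -
      have "(\<Prod>j\<in>{1..m}. X (g j) \<omega> $$ (row \<eta> j, col \<eta> j)) =
          (\<Prod>j\<in>{1..m}. 1 / sqrt (real N) * f (g j) (row \<eta> j) (col \<eta> j) \<omega>)"
        using bounds[OF \<eta>] by (intro prod.cong refl assms(8) \<omega>) auto
      then show ?thesis by (simp only: prod.distrib prod_constant card_atLeastAtMost) simp
    qed
    then have "(\<Prod>k = 1..r. Y N ns X g D k \<omega>) = (1 / real N) ^ r *
        (\<Sum>\<eta>\<in>PiE (pm_set m) ?T. \<Delta> \<eta> *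
          ((1 / sqrt (real N)) ^ m * (\<Prod>j\<in>{1..m}. f (g j) (row \<eta> j) (col \<eta> j) \<omega>)))"
      using prod_Y_expansion[where M = M and N = N and ns = ns and r = r and m = m and X = X
          and D = D and g = g and \<omega> = \<omega>, OF m assms(5) assms(7)[OF \<omega>] D]
      by (simp add: row_def col_def \<gamma>_def \<Delta>_def)
    then show ?thesis
      unfolding scale[symmetric] sum_distrib_left by (simp add: mult_ac)
  qed
  have gauss: "gaussian_rv P (\<lambda>\<omega>. \<Sum>j\<in>A. f (g j) (row \<eta> j) (col \<eta> j) \<omega>)"
    if \<eta>: "\<eta> \<in> PiE (pm_set m) ?T" and A: "A \<subseteq> {1..m}" for \<eta> A
  proof -
    have "(\<lambda>j. (g j, row \<eta> j, col \<eta> j)) ` A \<subseteq> UNIV \<times> {..<M} \<times> {..<N}"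
      using bounds[OF \<eta>] A by blast
    from jointly_gaussian_sum_family[OF assms(9) _ this] show ?thesis
      using finite_subset[OF A] by simp
  qed
  have covariance: "(\<integral>\<omega>. f h i j \<omega> * f h' i' j' \<omega> \<partial>P) = inner h h' * of_bool (i = i' \<and> j = j')"
    if ij: "i < M" "j < N" "i' < M" "j' < N" for h h' i j i' j'
  proof (cases "(i, j) = (i', j')")
    case True
    then show ?thesis using assms(12)[of i j h h'] ij by simp
  next
    case False
    have int: "integrable P (f h i j)" if "i < M" "j < N" for h i j
      using jointly_gaussian_sum_family[OF assms(9), of "{()}" "\<lambda>_. (h, i, j)"] that
        gaussian_rv_integrable[OF assms(1)] by simp
    have "(\<integral>\<omega>. f h i j \<omega> * f h' i' j' \<omega> \<partial>P) = expectation (f h i j) * expectation (f h' i' j')"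
      by (rule indep_var_lebesgue_integral[OF assms(11) int int]) (use ij False in auto)
    then show ?thesis using assms(10) ij False by auto
  qed
  have wick: "integrable P (\<lambda>\<omega>. \<Prod>j\<in>{1..m}. f (g j) (row \<eta> j) (col \<eta> j) \<omega>)"
    "(\<integral>\<omega>. (\<Prod>j\<in>{1..m}. f (g j) (row \<eta> j) (col \<eta> j) \<omega>) \<partial>P) =
      (\<Sum>\<pi>\<in>pairings m. w \<pi> * of_bool (compat \<pi> \<eta>))"
    if \<eta>: "\<eta> \<in> PiE (pm_set m) ?T" for \<eta>
  proof -
    let ?Z = "\<lambda>j. f (g j) (row \<eta> j) (col \<eta> j)"
    have card: "card {1..m} = 2 * n" by (simp add: m_def)
    have mean: "integral\<^sup>L P (?Z j) = 0" if "j \<in> {1..m}" for j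
      using assms(10) bounds[OF \<eta> that] by simp
    show "integrable P (\<lambda>\<omega>. \<Prod>j\<in>{1..m}. ?Z j \<omega>)"
      using wick_formula(1)[OF assms(1) _ card gauss[OF \<eta>] mean] by simp
    have "(\<integral>\<omega>. (\<Prod>j\<in>{1..m}. ?Z j \<omega>) \<partial>P) =
        (\<Sum>\<pi>\<in>pair_partitions {1..m}. \<Prod>B\<in>\<pi>. \<integral>\<omega>. ?Z (Min B) \<omega> * ?Z (Max B) \<omega> \<partial>P)"
      using wick_formula(2)[OF assms(1) _ card gauss[OF \<eta>] mean] by simp
    also have "\<dots> = (\<Sum>\<pi>\<in>pairings m. w \<pi> * of_bool (compat \<pi> \<eta>))"
    proof (rule sum.cong)
      show "pair_partitions {1..m} = pairings m" by (simp add: pair_partitions_def pairings_def)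
      fix \<pi> assume \<pi>: "\<pi> \<in> pairings m"
      interpret pairing_premap m \<gamma> "pairing_perm \<pi>" "\<sigma> \<pi>"
        unfolding \<gamma>_def \<sigma>_def by (rule pairing_premap_gamma[OF \<pi> m assms(5)])
      have fin: "finite \<pi>" using \<pi> finite_elements[of "{1..m}" \<pi>] by (auto simp: pairings_def)
      have "(\<Prod>B\<in>\<pi>. \<integral>\<omega>. ?Z (Min B) \<omega> * ?Z (Max B) \<omega> \<partial>P) =
          (\<Prod>B\<in>\<pi>. inner (g (Min B)) (g (Max B)) *
            of_bool (row \<eta> (Min B) = row \<eta> (Max B) \<and> col \<eta> (Min B) = col \<eta> (Max B)))"
        using pairing_perm_Min(1,2)[OF \<pi>] bounds[OF \<eta>] by (intro prod.cong refl covariance) blast+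
      also have "\<dots> = w \<pi> * of_bool (\<forall>B\<in>\<pi>. row \<eta> (Min B) = row \<eta> (Max B) \<and> col \<eta> (Min B) = col \<eta> (Max B))"
        using fin by (auto simp: w_def prod.distrib prod_zero_iff of_bool_def)
      also have "(\<forall>B\<in>\<pi>. row \<eta> (Min B) = row \<eta> (Max B) \<and> col \<eta> (Min B) = col \<eta> (Max B)) \<longleftrightarrow> compat \<pi> \<eta>"
        using ball_pairing_iff[OF \<pi>, of "\<lambda>k. (row_index \<gamma> \<eta> k, col_index \<gamma> \<eta> k)"]
        unfolding compat_def compatible_iff row_def col_def by simp
      finally show "(\<Prod>B\<in>\<pi>. \<integral>\<omega>. ?Z (Min B) \<omega> * ?Z (Max B) \<omega> \<partial>P) = w \<pi> * of_bool (compat \<pi> \<eta>)" .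
    qed
    finally show "(\<integral>\<omega>. (\<Prod>j\<in>{1..m}. ?Z j \<omega>) \<partial>P) = (\<Sum>\<pi>\<in>pairings m. w \<pi> * of_bool (compat \<pi> \<eta>))" .
  qed
  let ?c = "real N powi (- int n - int r)"
  have "integrable P (\<lambda>\<omega>. \<Prod>k = 1..r. Y N ns X g D k \<omega>) \<longleftrightarrow>
      integrable P (\<lambda>\<omega>. \<Sum>\<eta>\<in>PiE (pm_set m) ?T. ?c * \<Delta> \<eta> * (\<Prod>j\<in>{1..m}. f (g j) (row \<eta> j) (col \<eta> j) \<omega>))"
    by (rule Bochner_Integration.integrable_cong[OF refl Y_eq])
  then have integrable: "integrable P (\<lambda>\<omega>. \<Prod>k = 1..r. Y N ns X g D k \<omega>)"
    using wick(1) by (simp add: Bochner_Integration.integrable_sum)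
  have "expectation (\<lambda>\<omega>. \<Prod>k = 1..r. Y N ns X g D k \<omega>) =
      (\<integral>\<omega>. (\<Sum>\<eta>\<in>PiE (pm_set m) ?T. ?c * \<Delta> \<eta> * (\<Prod>j\<in>{1..m}. f (g j) (row \<eta> j) (col \<eta> j) \<omega>)) \<partial>P)"
    by (rule Bochner_Integration.integral_cong[OF refl Y_eq])
  also have "\<dots> = (\<Sum>\<eta>\<in>PiE (pm_set m) ?T. ?c * \<Delta> \<eta> * (\<Sum>\<pi>\<in>pairings m. w \<pi> * of_bool (compat \<pi> \<eta>)))"
    using wick by (subst Bochner_Integration.integral_sum) (auto intro!: sum.cong)
  also have "\<dots> = ?c * (\<Sum>\<pi>\<in>pairings m. w \<pi> * (\<Sum>\<eta>\<in>PiE (pm_set m) ?T. \<Delta> \<eta> * of_bool (compat \<pi> \<eta>)))"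
    unfolding sum_distrib_left by (subst sum.swap) (simp add: mult_ac)
  also have "\<dots> = ?c * (\<Sum>\<pi>\<in>pairings m. w \<pi> * Tr_perm (half_dom m (\<sigma> \<pi>)) (half_perm m (\<sigma> \<pi>)) D)"
  proof (intro arg_cong[of _ _ "(*) ?c"] sum.cong refl arg_cong[of _ _ "(*) (w _)"])
    fix \<pi> assume \<pi>: "\<pi> \<in> pairings m"
    interpret pairing_premap m \<gamma> "pairing_perm \<pi>" "\<sigma> \<pi>"
      unfolding \<gamma>_def \<sigma>_def by (rule pairing_premap_gamma[OF \<pi> m assms(5)])
    show "(\<Sum>\<eta>\<in>PiE (pm_set m) ?T. \<Delta> \<eta> * of_bool (compat \<pi> \<eta>)) =
        Tr_perm (half_dom m (\<sigma> \<pi>)) (half_perm m (\<sigma> \<pi>)) D"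
      unfolding \<Delta>_def compat_def by (rule Tr_perm_half[where d = ?d and D = D, OF D, symmetric]) (auto simp: index_dim_def)
  qed
  finally show ?thesis
    using integrable by (simp add: m_def w_def \<sigma>_def Let_def)
qed

end
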